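(* Let $M$ be a monoid, let $X$ be a set, and let $R$ be a set of admissible identities over $X^*$. Let $\eta_R\colon \mathcal{FR}_R(M)\to E(\mathcal{FI}_R(M))\rtimes M$ be the morphism of restriction monoids determined by $\eta_R(\lfloor m\rfloor)=([m]^+,m)$ for all $m\in M$. Then $\eta_R$ is an isomorphism of restriction monoids.
   Context: Restriction monoids. A restriction semigroup is an algebra $(S;\cdot,{}^*,{}^+)$ with $(S;\cdot)$ a semigroup satisfying $x^+x=x$, $x^+y^+=y^+x^+$, $(x^+y)^+=x^+y^+$, $xy^+=(xy)^+x$; $xx^*=x$, $x^*y^*=y^*x^*$, $(xy^* )^*=x^*y^*$, $x^*y=y(xy)^*$; $(x^+)^*=x^+$, $(x^* )^+=x^*$. A restriction monoid is a restriction semigroup with an identity element, in signature $(\cdot,{}^*,{}^+,1)$; morphisms preserve all operations. $P(S)=\{s^*:s\in S\}=\{s^+:s\in S\}$ is the semilattice of projections. Natural partial order: $s\le t$ iff $s=et$ for some $e\in P(S)$. Every inverse monoid is a restriction monoid with $s^*=s^{-1}s$, $s^+=ss^{-1}$, and then $P(S)=E(S)$, the semilattice of idempotents. Premorphisms. A premorphism from a monoid $M$ to a restriction monoid $T$ is a map $\varphi$ with $\varphi(1)=1$ and $\varphi(m)\varphi(n)\le\varphi(mn)$ for all $m,n\in M$; it is a monoid morphism if $\varphi(m)\varphi(n)=\varphi(mn)$ always. Identities. $X^*$ is the free monoid on a set $X$ (empty word $\lambda$), and $FR(X^* )$ is the free restriction monoid on the set $X^*$ (its product is written $\cdot$, its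 identity is $1\neq\lambda$; the generator $uv$ is different from the product $u\cdot v$). For a map $f\colon X\to M$ into a monoid, with monoid-morphism extension $\widehat f\colon X^*\to M$, and a map $\gamma\colon M\to S$ into a restriction monoid, the value $[p]_{\gamma,f}\in S$ of $p\in FR(X^* )$ is the image of $p$ under the morphism $FR(X^* )\to S$ sending each generator $u\in X^*$ to $\gamma(\widehat f(u))$. An identity over $X^*$ is an equality $p=q$ with $p,q\in FR(X^* )$; $\gamma$ satisfies it if $[p]_{\gamma,f}=[q]_{\gamma,f}$ for all $f\colon X\to M$. An identity is admissible if every monoid morphism from a monoid to a restriction monoid satisfies it. Free objects. $\mathcal{FR}_R(M)$ is the restriction monoid generated by the set $\{\lfloor m\rfloor:m\in M\}$ subject to the relations $\lfloor 1\rfloor=1$, $\lfloor m\rfloor\lfloor n\rfloor=\lfloor mn\rfloor(\lfloor m\rfloor\lfloor n\rfloor)^*$ ($m,n\in M$), and $[p]_{\iota,f}=[q]_{\iota,f}$ for all identities $p=q$ in $R$ and all $f\colon X\to M$, where $\iota(m)=\lfloor m\rfloor$. $\mathcal{FI}_R(M)$ is the inverse monoid generated by the set $\{[m]:m\in M\}$ subject to the relations $[1]=1$, $[m][n]=[mn]([m][n])^*$, and $[p]_{\iota,f}=[q]_{\iota,f}$ for all $p=q$ in $R$ and all $f\colon X\to M$, where $\iota(m)=[m]$. (Thus both are universal for premorphisms from $M$ satisfying $R$, into restriction monoids and inverse monoids, respectively.) Partial action product. $E(\mathcal{FI}_R(M))\rtimes M=\{(e,m)\in E(\mathcal{FI}_R(M))\times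 M: e\le [m]^+\}$, a restriction monoid with identity $(1,1)$ and operations $(e,m)(f,n)=(e([m]f)^+,mn)$, $(e,m)^*=((e[m])^*,1)$, $(e,m)^+=(e,1)$. The map $m\mapsto([m]^+,m)$ is a premorphism satisfying $R$, so $\eta_R$ exists by the universal property of $\mathcal{FR}_R(M)$. *)

theory Defs
  imports "HOL-Algebra.Group"
begin

section \<open>Restriction monoids\<close>

record 'a restr = "'a monoid" +
  rstar :: "'a \<Rightarrow> 'a"
  rplus :: "'a \<Rightarrow> 'a"

locale restriction_monoid = monoid S for S :: "('a, 'b) restr_scheme" (structure) +
  assumes star_closed [simp, intro]: "x \<in> carrier S \<Longrightarrow> rstar S x \<in> carrier S"
    and plus_closed [simp, intro]: "x \<in> carrier S \<Longrightarrow> rplus S x \<in> carrier S"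
    and plus_left_id: "x \<in> carrier S \<Longrightarrow> rplus S x \<otimes> x = x"
    and plus_comm: "\<lbrakk>x \<in> carrier S; y \<in> carrier S\<rbrakk>
          \<Longrightarrow> rplus S x \<otimes> rplus S y = rplus S y \<otimes> rplus S x"
    and plus_plus_mult: "\<lbrakk>x \<in> carrier S; y \<in> carrier S\<rbrakk>
          \<Longrightarrow> rplus S (rplus S x \<otimes> y) = rplus S x \<otimes> rplus S y"
    and plus_ample: "\<lbrakk>x \<in> carrier S; y \<in> carrier S\<rbrakk>
          \<Longrightarrow> x \<otimes> rplus S y = rplus S (x \<otimes> y) \<otimes> x"
    and star_right_id: "x \<in> carrier S \<Longrightarrow> x \<otimes> rstar S x = x"
    and star_comm: "\<lbrakk>x \<in> carrier S; y \<in> carrier S\<rbrakk>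
          \<Longrightarrow> rstar S x \<otimes> rstar S y = rstar S y \<otimes> rstar S x"
    and star_mult_star: "\<lbrakk>x \<in> carrier S; y \<in> carrier S\<rbrakk>
          \<Longrightarrow> rstar S (x \<otimes> rstar S y) = rstar S x \<otimes> rstar S y"
    and star_ample: "\<lbrakk>x \<in> carrier S; y \<in> carrier S\<rbrakk>
          \<Longrightarrow> rstar S x \<otimes> y = y \<otimes> rstar S (x \<otimes> y)"
    and star_plus: "x \<in> carrier S \<Longrightarrow> rstar S (rplus S x) = rplus S x"
    and plus_star: "x \<in> carrier S \<Longrightarrow> rplus S (rstar S x) = rstar S x"

definition proj :: "('a, 'b) restr_scheme \<Rightarrow> 'a set" where
  "proj S = rstar S ` carrier S"

definition nat_le :: "('a, 'b) restr_scheme \<Rightarrow> 'a \<Rightarrow> 'a \<Rightarrow> bool" where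
  "nat_le S s t \<longleftrightarrow> (\<exists>e\<in>proj S. s = e \<otimes>\<^bsub>S\<^esub> t)"

definition mon_hom :: "('a, 'c) monoid_scheme \<Rightarrow> ('b, 'd) monoid_scheme \<Rightarrow> ('a \<Rightarrow> 'b) set" where
  "mon_hom M N = {h \<in> hom M N. h \<one>\<^bsub>M\<^esub> = \<one>\<^bsub>N\<^esub>}"

definition restr_hom :: "('a, 'c) restr_scheme \<Rightarrow> ('b, 'd) restr_scheme \<Rightarrow> ('a \<Rightarrow> 'b) set" where
  "restr_hom S T = {h \<in> mon_hom S T. \<forall>x\<in>carrier S.
     h (rstar S x) = rstar T (h x) \<and> h (rplus S x) = rplus T (h x)}"

definition restr_iso :: "('a, 'c) restr_scheme \<Rightarrow> ('b, 'd) restr_scheme \<Rightarrow> ('a \<Rightarrow> 'b) set" where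
  "restr_iso S T = {h \<in> restr_hom S T. bij_betw h (carrier S) (carrier T)}"


section \<open>Inverse monoids\<close>

locale inverse_monoid = monoid S for S :: "('a, 'b) monoid_scheme" (structure) +
  assumes ex1_inverse: "x \<in> carrier S \<Longrightarrow>
    \<exists>!y. y \<in> carrier S \<and> x \<otimes> y \<otimes> x = x \<and> y \<otimes> x \<otimes> y = y"

text \<open>The inverse \<open>s\<^sup>-\<^sup>1\<close> of inverse semigroup theory; \<^const>\<open>m_inv\<close> is the inverse of a unit.\<close>

definition sinv :: "('a, 'b) monoid_scheme \<Rightarrow> 'a \<Rightarrow> 'a" where
  "sinv S x = (THE y. y \<in> carrier S \<and> x \<otimes>\<^bsub>S\<^esub> y \<otimes>\<^bsub>S\<^esub> x = x \<and> y \<otimes>\<^bsub>S\<^esub> x \<otimes>\<^bsub>S\<^esub> y = y)"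

definition idems :: "('a, 'b) monoid_scheme \<Rightarrow> 'a set" where
  "idems S = {e \<in> carrier S. e \<otimes>\<^bsub>S\<^esub> e = e}"

definition inv_restr :: "('a, 'b) monoid_scheme \<Rightarrow> 'a restr" where
  "inv_restr S = \<lparr>carrier = carrier S, mult = mult S, one = one S,
     rstar = (\<lambda>s. sinv S s \<otimes>\<^bsub>S\<^esub> s), rplus = (\<lambda>s. s \<otimes>\<^bsub>S\<^esub> sinv S s)\<rparr>"


section \<open>Presentations of restriction monoids\<close>

datatype (rgens: 'a) rterm =
    RGen 'a
  | ROne
  | RMult "'a rterm" "'a rterm"  (infixl \<open>\<cdot>\<close> 70)
  | RStar "'a rterm"
  | RPlus "'a rterm"

definition rterms :: "'a set \<Rightarrow> 'a rterm set" where
  "rterms A = {t. rgens t \<subseteq> A}"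

inductive_set restr_laws :: "('a rterm \<times> 'a rterm) set" where
  "(r \<cdot> s \<cdot> t, r \<cdot> (s \<cdot> t)) \<in> restr_laws"
| "(ROne \<cdot> s, s) \<in> restr_laws"
| "(s \<cdot> ROne, s) \<in> restr_laws"
| "(RPlus s \<cdot> s, s) \<in> restr_laws"
| "(RPlus s \<cdot> RPlus t, RPlus t \<cdot> RPlus s) \<in> restr_laws"
| "(RPlus (RPlus s \<cdot> t), RPlus s \<cdot> RPlus t) \<in> restr_laws"
| "(s \<cdot> RPlus t, RPlus (s \<cdot> t) \<cdot> s) \<in> restr_laws"
| "(s \<cdot> RStar s, s) \<in> restr_laws"
| "(RStar s \<cdot> RStar t, RStar t \<cdot> RStar s) \<in> restr_laws"
| "(RStar (s \<cdot> RStar t), RStar s \<cdot> RStar t) \<in> restr_laws"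
| "(RStar s \<cdot> t, t \<cdot> RStar (s \<cdot> t)) \<in> restr_laws"
| "(RStar (RPlus s), RPlus s) \<in> restr_laws"
| "(RPlus (RStar s), RStar s) \<in> restr_laws"

inductive_set rcong :: "'a set \<Rightarrow> ('a rterm \<times> 'a rterm) set \<Rightarrow> ('a rterm \<times> 'a rterm) set"
  for A \<rho> where
  base: "\<lbrakk>(s, t) \<in> restr_laws \<union> \<rho>; s \<in> rterms A; t \<in> rterms A\<rbrakk> \<Longrightarrow> (s, t) \<in> rcong A \<rho>"
| refl: "s \<in> rterms A \<Longrightarrow> (s, s) \<in> rcong A \<rho>"
| sym: "(s, t) \<in> rcong A \<rho> \<Longrightarrow> (t, s) \<in> rcong A \<rho>"
| trans: "\<lbrakk>(r, s) \<in> rcong A \<rho>; (s, t) \<in> rcong A \<rho>\<rbrakk> \<Longrightarrow> (r, t) \<in> rcong A \<rho>"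
| mult: "\<lbrakk>(s, s') \<in> rcong A \<rho>; (t, t') \<in> rcong A \<rho>\<rbrakk> \<Longrightarrow> (s \<cdot> t, s' \<cdot> t') \<in> rcong A \<rho>"
| star: "(s, s') \<in> rcong A \<rho> \<Longrightarrow> (RStar s, RStar s') \<in> rcong A \<rho>"
| plus: "(s, s') \<in> rcong A \<rho> \<Longrightarrow> (RPlus s, RPlus s') \<in> rcong A \<rho>"

definition rpres :: "'a set \<Rightarrow> ('a rterm \<times> 'a rterm) set \<Rightarrow> 'a rterm set restr" where
  "rpres A \<rho> = \<lparr>carrier = rterms A // rcong A \<rho>,
     mult = (\<lambda>P Q. \<Union>s\<in>P. \<Union>t\<in>Q. rcong A \<rho> `` {s \<cdot> t}),
     one = rcong A \<rho> `` {ROne},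
     rstar = (\<lambda>P. \<Union>s\<in>P. rcong A \<rho> `` {RStar s}),
     rplus = (\<lambda>P. \<Union>s\<in>P. rcong A \<rho> `` {RPlus s})\<rparr>"

abbreviation free_restr :: "'a set \<Rightarrow> 'a rterm set restr" where
  "free_restr A \<equiv> rpres A {}"

fun reval :: "('b, 'c) restr_scheme \<Rightarrow> ('a \<Rightarrow> 'b) \<Rightarrow> 'a rterm \<Rightarrow> 'b" where
  "reval S g (RGen a) = g a"
| "reval S g ROne = \<one>\<^bsub>S\<^esub>"
| "reval S g (s \<cdot> t) = reval S g s \<otimes>\<^bsub>S\<^esub> reval S g t"
| "reval S g (RStar s) = rstar S (reval S g s)"
| "reval S g (RPlus s) = rplus S (reval S g s)"

text \<open>The morphism from a presented restriction monoid that extends \<open>g\<close>: all terms in a class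
  have the same value, see \<open>rext_morphism\<close> and \<open>rext_unique\<close> below.\<close>

definition rext :: "('b, 'c) restr_scheme \<Rightarrow> ('a \<Rightarrow> 'b) \<Rightarrow> 'a rterm set \<Rightarrow> 'b" where
  "rext S g P = the_elem (reval S g ` P)"


section \<open>Presentations of inverse monoids\<close>

datatype (igens: 'a) iterm =
    IGen 'a
  | IOne
  | IMult "'a iterm" "'a iterm"  (infixl \<open>\<odot>\<close> 70)
  | IInv "'a iterm"

definition iterms :: "'a set \<Rightarrow> 'a iterm set" where
  "iterms A = {t. igens t \<subseteq> A}"

text \<open>The usual equational axioms of inverse monoids in the signature \<open>(\<cdot>, \<^sup>-\<^sup>1, 1)\<close>.  That they
  are adequate for the locale \<^locale>\<open>inverse_monoid\<close> is shown by \<open>ipres_inverse_monoid\<close> and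
  \<open>iext_morphism\<close> below.\<close>

inductive_set inv_laws :: "('a iterm \<times> 'a iterm) set" where
  "(r \<odot> s \<odot> t, r \<odot> (s \<odot> t)) \<in> inv_laws"
| "(IOne \<odot> s, s) \<in> inv_laws"
| "(s \<odot> IOne, s) \<in> inv_laws"
| "(s \<odot> IInv s \<odot> s, s) \<in> inv_laws"
| "(IInv (IInv s), s) \<in> inv_laws"
| "(IInv (s \<odot> t), IInv t \<odot> IInv s) \<in> inv_laws"
| "(s \<odot> IInv s \<odot> (t \<odot> IInv t), t \<odot> IInv t \<odot> (s \<odot> IInv s)) \<in> inv_laws"

inductive_set icong :: "'a set \<Rightarrow> ('a iterm \<times> 'a iterm) set \<Rightarrow> ('a iterm \<times> 'a iterm) set"
  for A \<rho> where
  base: "\<lbrakk>(s, t) \<in> inv_laws \<union> \<rho>; s \<in> iterms A; t \<in> iterms A\<rbrakk> \<Longrightarrow> (s, t) \<in> icong A \<rho>"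
| refl: "s \<in> iterms A \<Longrightarrow> (s, s) \<in> icong A \<rho>"
| sym: "(s, t) \<in> icong A \<rho> \<Longrightarrow> (t, s) \<in> icong A \<rho>"
| trans: "\<lbrakk>(r, s) \<in> icong A \<rho>; (s, t) \<in> icong A \<rho>\<rbrakk> \<Longrightarrow> (r, t) \<in> icong A \<rho>"
| mult: "\<lbrakk>(s, s') \<in> icong A \<rho>; (t, t') \<in> icong A \<rho>\<rbrakk> \<Longrightarrow> (s \<odot> t, s' \<odot> t') \<in> icong A \<rho>"
| inv: "(s, s') \<in> icong A \<rho> \<Longrightarrow> (IInv s, IInv s') \<in> icong A \<rho>"

definition ipres :: "'a set \<Rightarrow> ('a iterm \<times> 'a iterm) set \<Rightarrow> 'a iterm set monoid" where
  "ipres A \<rho> = \<lparr>carrier = iterms A // icong A \<rho>,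
     mult = (\<lambda>P Q. \<Union>s\<in>P. \<Union>t\<in>Q. icong A \<rho> `` {s \<odot> t}),
     one = icong A \<rho> `` {IOne}\<rparr>"

fun ieval :: "('b, 'c) monoid_scheme \<Rightarrow> ('a \<Rightarrow> 'b) \<Rightarrow> 'a iterm \<Rightarrow> 'b" where
  "ieval S g (IGen a) = g a"
| "ieval S g IOne = \<one>\<^bsub>S\<^esub>"
| "ieval S g (s \<odot> t) = ieval S g s \<otimes>\<^bsub>S\<^esub> ieval S g t"
| "ieval S g (IInv s) = sinv S (ieval S g s)"

definition iext :: "('b, 'c) monoid_scheme \<Rightarrow> ('a \<Rightarrow> 'b) \<Rightarrow> 'a iterm set \<Rightarrow> 'b" where
  "iext S g P = the_elem (ieval S g ` P)"


section \<open>Identities\<close>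

definition word_ext :: "('m, 'k) monoid_scheme \<Rightarrow> ('x \<Rightarrow> 'm) \<Rightarrow> 'x list \<Rightarrow> 'm" where
  "word_ext M f u = foldr (mult M) (map f u) \<one>\<^bsub>M\<^esub>"

text \<open>\<open>FR(X\<^sup>*)\<close>.  The empty word is the generator \<^term>\<open>RGen []\<close>, which is not the identity, and
  \<^term>\<open>RGen (u @ v)\<close> is not identified with \<^term>\<open>RGen u \<cdot> RGen v\<close>.\<close>

abbreviation FR_words :: "'x set \<Rightarrow> 'x list rterm set restr" where
  "FR_words X \<equiv> free_restr (lists X)"

definition ident_value ::
  "('m, 'k) monoid_scheme \<Rightarrow> ('s, 'l) restr_scheme \<Rightarrow> ('m \<Rightarrow> 's) \<Rightarrow> ('x \<Rightarrow> 'm)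
    \<Rightarrow> 'x list rterm set \<Rightarrow> 's" where
  "ident_value M S \<gamma> f = rext S (\<gamma> \<circ> word_ext M f)"

definition satisfies ::
  "'x set \<Rightarrow> ('m, 'k) monoid_scheme \<Rightarrow> ('s, 'l) restr_scheme \<Rightarrow> ('m \<Rightarrow> 's)
    \<Rightarrow> 'x list rterm set \<times> 'x list rterm set \<Rightarrow> bool" where
  "satisfies X M S \<gamma> = (\<lambda>(p, q). \<forall>f \<in> X \<rightarrow> carrier M. ident_value M S \<gamma> f p = ident_value M S \<gamma> f q)"

text \<open>Admissibility quantifies over all monoids and all restriction monoids.  A HOL definition has
  to fix the types of their elements.  The types chosen here contain \<open>X\<^sup>*\<close> and its universal monoid
  morphism into a restriction monoid, so they lose nothing: by \<open>admissible_satisfies\<close> below, an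
  admissible identity is satisfied by every monoid morphism from a monoid to a restriction monoid,
  over arbitrary types.\<close>

definition admissible ::
  "'x set \<Rightarrow> 'x list rterm set \<times> 'x list rterm set \<Rightarrow> bool" where
  "admissible X pq \<longleftrightarrow>
    (\<forall>(M :: 'x list monoid) (S :: 'x list rterm set restr) \<gamma>.
       monoid M \<and> restriction_monoid S \<and> \<gamma> \<in> mon_hom M S \<longrightarrow> satisfies X M S \<gamma> pq)"


section \<open>The universal monoids of premorphisms\<close>

text \<open>Term algebras in the signature of restriction monoids (no laws are imposed), used to write
  down the defining relations of both presentations at once.\<close>

definition rterm_alg :: "'a rterm restr" where
  "rterm_alg = \<lparr>carrier = UNIV, mult = RMult, one = ROne, rstar = RStar, rplus = RPlus\<rparr>"

definition iterm_alg :: "'a iterm restr" where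
  "iterm_alg = \<lparr>carrier = UNIV, mult = IMult, one = IOne,
     rstar = (\<lambda>s. IInv s \<odot> s), rplus = (\<lambda>s. s \<odot> IInv s)\<rparr>"

text \<open>In the third set an identity is instantiated at all terms representing its two sides.\<close>

definition premorphism_rels ::
  "('m, 'k) monoid_scheme \<Rightarrow> 'x set \<Rightarrow> ('x list rterm set \<times> 'x list rterm set) set
    \<Rightarrow> 't restr \<Rightarrow> ('m \<Rightarrow> 't) \<Rightarrow> ('t \<times> 't) set" where
  "premorphism_rels M X R T \<iota> =
     {(\<iota> \<one>\<^bsub>M\<^esub>, \<one>\<^bsub>T\<^esub>)}
     \<union> {(\<iota> m \<otimes>\<^bsub>T\<^esub> \<iota> n, \<iota> (m \<otimes>\<^bsub>M\<^esub> n) \<otimes>\<^bsub>T\<^esub> rstar T (\<iota> m \<otimes>\<^bsub>T\<^esub> \<iota> n)) | m n.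
          m \<in> carrier M \<and> n \<in> carrier M}
     \<union> {(reval T (\<iota> \<circ> word_ext M f) s, reval T (\<iota> \<circ> word_ext M f) t) | p q s t f.
          (p, q) \<in> R \<and> s \<in> p \<and> t \<in> q \<and> f \<in> X \<rightarrow> carrier M}"

definition FR_rels where
  "FR_rels M X R = premorphism_rels M X R rterm_alg RGen"

definition FI_rels where
  "FI_rels M X R = premorphism_rels M X R iterm_alg IGen"

definition FR ::
  "('m, 'k) monoid_scheme \<Rightarrow> 'x set \<Rightarrow> ('x list rterm set \<times> 'x list rterm set) set
    \<Rightarrow> 'm rterm set restr" where
  "FR M X R = rpres (carrier M) (FR_rels M X R)"

definition FR_gen where
  "FR_gen M X R m = rcong (carrier M) (FR_rels M X R) `` {RGen m}"

definition FI ::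
  "('m, 'k) monoid_scheme \<Rightarrow> 'x set \<Rightarrow> ('x list rterm set \<times> 'x list rterm set) set
    \<Rightarrow> 'm iterm set restr" where
  "FI M X R = inv_restr (ipres (carrier M) (FI_rels M X R))"

definition FI_gen where
  "FI_gen M X R m = icong (carrier M) (FI_rels M X R) `` {IGen m}"


section \<open>The partial action product\<close>

definition partial_action_product ::
  "('m, 'k) monoid_scheme \<Rightarrow> 's restr \<Rightarrow> ('m \<Rightarrow> 's) \<Rightarrow> ('s \<times> 'm) restr" where
  "partial_action_product M S \<iota> =
    \<lparr>carrier = {(e, m). e \<in> idems S \<and> m \<in> carrier M \<and> nat_le S e (rplus S (\<iota> m))},
     mult = (\<lambda>(e, m) (f, n). (e \<otimes>\<^bsub>S\<^esub> rplus S (\<iota> m \<otimes>\<^bsub>S\<^esub> f), m \<otimes>\<^bsub>M\<^esub> n)),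
     one = (\<one>\<^bsub>S\<^esub>, \<one>\<^bsub>M\<^esub>),
     rstar = (\<lambda>(e, m). (rstar S (e \<otimes>\<^bsub>S\<^esub> \<iota> m), \<one>\<^bsub>M\<^esub>)),
     rplus = (\<lambda>(e, m). (e, \<one>\<^bsub>M\<^esub>))\<rparr>"

abbreviation EFI_product ::
  "('m, 'k) monoid_scheme \<Rightarrow> 'x set \<Rightarrow> ('x list rterm set \<times> 'x list rterm set) set
    \<Rightarrow> ('m iterm set \<times> 'm) restr" where
  "EFI_product M X R \<equiv> partial_action_product M (FI M X R) (FI_gen M X R)"

definition is_eta ::
  "('m, 'k) monoid_scheme \<Rightarrow> 'x set \<Rightarrow> ('x list rterm set \<times> 'x list rterm set) set
    \<Rightarrow> ('m rterm set \<Rightarrow> 'm iterm set \<times> 'm) \<Rightarrow> bool" where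
  "is_eta M X R \<eta> \<longleftrightarrow> \<eta> \<in> restr_hom (FR M X R) (EFI_product M X R) \<and>
     (\<forall>m\<in>carrier M. \<eta> (FR_gen M X R m) = (rplus (FI M X R) (FI_gen M X R m), m))"


section \<open>Adequacy of the definitions\<close>

lemma rterms_simps [simp]:
  "RGen a \<in> rterms A \<longleftrightarrow> a \<in> A" "ROne \<in> rterms A"
  "s \<cdot> t \<in> rterms A \<longleftrightarrow> s \<in> rterms A \<and> t \<in> rterms A"
  "RStar s \<in> rterms A \<longleftrightarrow> s \<in> rterms A" "RPlus s \<in> rterms A \<longleftrightarrow> s \<in> rterms A"
  by (auto simp: rterms_def)

lemma rcong_rterms: "(s, t) \<in> rcong A \<rho> \<Longrightarrow> s \<in> rterms A \<and> t \<in> rterms A"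
  by (induction rule: rcong.induct) auto

lemma equiv_rcong: "equiv (rterms A) (rcong A \<rho>)"
  by (rule equivI)
     (auto simp: refl_on_def sym_def trans_def dest: rcong_rterms intro: rcong.refl rcong.sym rcong.trans)

lemma rclass_eq_iff:
  "\<lbrakk>s \<in> rterms A; t \<in> rterms A\<rbrakk> \<Longrightarrow>
     rcong A \<rho> `` {s} = rcong A \<rho> `` {t} \<longleftrightarrow> (s, t) \<in> rcong A \<rho>"
  using eq_equiv_class_iff[OF equiv_rcong] by metis

lemma rclass_eqI: "(s, t) \<in> rcong A \<rho> \<Longrightarrow> rcong A \<rho> `` {s} = rcong A \<rho> `` {t}"
  by (rule equiv_class_eq[OF equiv_rcong])

lemma rpres_carrier: "carrier (rpres A \<rho>) = (\<lambda>s. rcong A \<rho> `` {s}) ` rterms A"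
  by (auto simp: rpres_def quotient_def)

lemma rpres_one: "\<one>\<^bsub>rpres A \<rho>\<^esub> = rcong A \<rho> `` {ROne}"
  by (simp add: rpres_def)

lemma rpres_mult:
  assumes "s \<in> rterms A" "t \<in> rterms A"
  shows "(rcong A \<rho> `` {s}) \<otimes>\<^bsub>rpres A \<rho>\<^esub> (rcong A \<rho> `` {t}) = rcong A \<rho> `` {s \<cdot> t}"
proof -
  have "congruent2 (rcong A \<rho>) (rcong A \<rho>) (\<lambda>s t. rcong A \<rho> `` {s \<cdot> t})"
    by (auto simp: congruent2_def intro!: rclass_eqI rcong.mult)
  from UN_equiv_class2[OF equiv_rcong equiv_rcong this assms] show ?thesis
    by (simp add: rpres_def)
qed

lemma rpres_star:
  assumes "s \<in> rterms A"
  shows "rstar (rpres A \<rho>) (rcong A \<rho> `` {s}) = rcong A \<rho> `` {RStar s}"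
proof -
  have "congruent (rcong A \<rho>) (\<lambda>s. rcong A \<rho> `` {RStar s})"
    by (auto simp: congruent_def intro!: rclass_eqI rcong.star)
  from UN_equiv_class[OF equiv_rcong this assms] show ?thesis
    by (simp add: rpres_def)
qed

lemma rpres_plus:
  assumes "s \<in> rterms A"
  shows "rplus (rpres A \<rho>) (rcong A \<rho> `` {s}) = rcong A \<rho> `` {RPlus s}"
proof -
  have "congruent (rcong A \<rho>) (\<lambda>s. rcong A \<rho> `` {RPlus s})"
    by (auto simp: congruent_def intro!: rclass_eqI rcong.plus)
  from UN_equiv_class[OF equiv_rcong this assms] show ?thesis
    by (simp add: rpres_def)
qed

lemmas rpres_ops = rpres_one rpres_mult rpres_star rpres_plus

lemma rpres_restriction_monoid: "restriction_monoid (rpres A \<rho>)"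
proof -
  have law: "rcong A \<rho> `` {s} = rcong A \<rho> `` {t}"
    if "(s, t) \<in> restr_laws" "s \<in> rterms A" "t \<in> rterms A" for s t
    using that by (auto intro!: rclass_eqI rcong.base)
  show ?thesis
    by unfold_locales
       (auto simp: rpres_carrier rpres_ops del: equalityI intro!: law, (rule restr_laws.intros)+)
qed

lemma (in restriction_monoid) reval_closed:
  assumes "g \<in> A \<rightarrow> carrier S" "t \<in> rterms A"
  shows "reval S g t \<in> carrier S"
  using assms(2) by (induction t) (use assms(1) in auto)

lemma (in restriction_monoid) reval_laws:
  assumes "g \<in> A \<rightarrow> carrier S" "(s, t) \<in> restr_laws" "s \<in> rterms A" "t \<in> rterms A"
  shows "reval S g s = reval S g t"
  using assms(2-4) reval_closed[OF assms(1)]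
  by (cases rule: restr_laws.cases)
     (simp_all only: reval.simps rterms_simps m_assoc l_one r_one plus_left_id plus_comm
        plus_plus_mult plus_ample[symmetric] star_right_id star_comm star_mult_star
        star_ample[symmetric] star_plus plus_star star_closed plus_closed m_closed)

lemma (in restriction_monoid) reval_rcong:
  assumes g: "g \<in> A \<rightarrow> carrier S"
    and rels: "\<forall>(s, t)\<in>\<rho>. reval S g s = reval S g t"
    and st: "(s, t) \<in> rcong A \<rho>"
  shows "reval S g s = reval S g t"
  using st
proof (induction rule: rcong.induct)
  case (base s t)
  then consider "(s, t) \<in> restr_laws" | "(s, t) \<in> \<rho>" by blast
  then show ?case using rels base by cases (auto intro: reval_laws[OF g])
qed simp_all

lemma (in restriction_monoid) rext_class:
  assumes g: "g \<in> A \<rightarrow> carrier S"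
    and rels: "\<forall>(s, t)\<in>\<rho>. reval S g s = reval S g t"
    and s: "s \<in> rterms A"
  shows "rext S g (rcong A \<rho> `` {s}) = reval S g s"
proof -
  have "reval S g ` (rcong A \<rho> `` {s}) = (\<lambda>_. reval S g s) ` (rcong A \<rho> `` {s})"
    by (rule image_cong[OF HOL.refl], rule reval_rcong[OF g rels, symmetric]) simp
  moreover have "rcong A \<rho> `` {s} \<noteq> {}"
    using rcong.refl[OF s, of \<rho>] by blast
  ultimately show ?thesis by (simp add: rext_def image_constant_conv)
qed

lemma (in restriction_monoid) rext_morphism:
  assumes g: "g \<in> A \<rightarrow> carrier S"
    and rels: "\<forall>(s, t)\<in>\<rho>. reval S g s = reval S g t"
  shows "rext S g \<in> restr_hom (rpres A \<rho>) S"
    and "a \<in> A \<Longrightarrow> rext S g (rcong A \<rho> `` {RGen a}) = g a"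
  by (auto simp: restr_hom_def mon_hom_def hom_def rpres_carrier rpres_ops
        rext_class[OF g rels] reval_closed[OF g])

lemma restr_hom_reval:
  assumes h: "h \<in> restr_hom (rpres A \<rho>) T" and t: "t \<in> rterms A"
  shows "h (rcong A \<rho> `` {t}) = reval T (\<lambda>a. h (rcong A \<rho> `` {RGen a})) t"
  using t
proof (induction t)
  case (RMult s t)
  then have "h (rcong A \<rho> `` {s} \<otimes>\<^bsub>rpres A \<rho>\<^esub> rcong A \<rho> `` {t})
      = h (rcong A \<rho> `` {s}) \<otimes>\<^bsub>T\<^esub> h (rcong A \<rho> `` {t})"
    using h by (auto simp: restr_hom_def mon_hom_def hom_def rpres_carrier)
  with RMult show ?case by (simp add: rpres_mult)
next
  case (RStar s)
  then have "h (rstar (rpres A \<rho>) (rcong A \<rho> `` {s})) = rstar T (h (rcong A \<rho> `` {s}))"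
    using h by (auto simp: restr_hom_def rpres_carrier)
  with RStar show ?case by (simp add: rpres_star)
next
  case (RPlus s)
  then have "h (rplus (rpres A \<rho>) (rcong A \<rho> `` {s})) = rplus T (h (rcong A \<rho> `` {s}))"
    using h by (auto simp: restr_hom_def rpres_carrier)
  with RPlus show ?case by (simp add: rpres_plus)
qed (use h in \<open>auto simp: restr_hom_def mon_hom_def rpres_one\<close>)

lemma reval_cong: "\<lbrakk>\<And>a. a \<in> A \<Longrightarrow> g a = g' a; t \<in> rterms A\<rbrakk> \<Longrightarrow> reval T g t = reval T g' t"
  by (induction t) auto

lemma rext_unique:
  assumes "h \<in> restr_hom (rpres A \<rho>) T" "h' \<in> restr_hom (rpres A \<rho>) T"
    and "\<And>a. a \<in> A \<Longrightarrow> h (rcong A \<rho> `` {RGen a}) = h' (rcong A \<rho> `` {RGen a})"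
    and "P \<in> carrier (rpres A \<rho>)"
  shows "h P = h' P"
  using assms(4) by (auto simp: rpres_carrier restr_hom_reval[OF assms(1)]
      restr_hom_reval[OF assms(2)] intro!: reval_cong assms(3))

corollary eta_unique:
  assumes "is_eta M X R \<eta>" "is_eta M X R \<eta>'" "P \<in> carrier (FR M X R)"
  shows "\<eta> P = \<eta>' P"
proof (rule rext_unique)
  show "\<eta> \<in> restr_hom (rpres (carrier M) (FR_rels M X R)) (EFI_product M X R)"
    "\<eta>' \<in> restr_hom (rpres (carrier M) (FR_rels M X R)) (EFI_product M X R)"
    "P \<in> carrier (rpres (carrier M) (FR_rels M X R))"
    using assms by (simp_all add: is_eta_def FR_def)
next
  fix m assume "m \<in> carrier M"
  then show "\<eta> (rcong (carrier M) (FR_rels M X R) `` {RGen m})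
      = \<eta>' (rcong (carrier M) (FR_rels M X R) `` {RGen m})"
    using assms by (simp add: is_eta_def FR_gen_def)
qed


subsection \<open>Admissibility does not depend on the choice of types\<close>

lemma (in monoid) word_ext_Nil [simp]: "word_ext G f [] = \<one>"
  by (simp add: word_ext_def)

lemma (in monoid) word_ext_closed:
  "\<lbrakk>f \<in> X \<rightarrow> carrier G; u \<in> lists X\<rbrakk> \<Longrightarrow> word_ext G f u \<in> carrier G"
  by (induction u) (auto simp: word_ext_def)

lemma (in monoid) word_ext_append:
  "\<lbrakk>f \<in> X \<rightarrow> carrier G; u \<in> lists X; v \<in> lists X\<rbrakk>
    \<Longrightarrow> word_ext G f (u @ v) = word_ext G f u \<otimes> word_ext G f v"
proof (induction u)
  case Nil
  then show ?case using word_ext_closed[of f X v] by simp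
next
  case (Cons x u)
  then have "f x \<in> carrier G" "u \<in> lists X" by auto
  moreover from this Cons have "word_ext G f u \<in> carrier G" "word_ext G f v \<in> carrier G"
    using word_ext_closed[of f X] by auto
  ultimately show ?case using Cons by (simp add: word_ext_def m_assoc)
qed

lemma restr_hom_rext:
  assumes "restriction_monoid S" "restriction_monoid T" and h: "h \<in> restr_hom S T"
    and g: "g \<in> A \<rightarrow> carrier S" and P: "P \<in> carrier (free_restr A)"
  shows "h (rext S g P) = rext T (h \<circ> g) P"
proof -
  interpret S: restriction_monoid S by fact
  interpret T: restriction_monoid T by fact
  have hg: "h \<circ> g \<in> A \<rightarrow> carrier T"
    using h g by (auto simp: restr_hom_def mon_hom_def hom_def)
  have *: "h (reval S g t) = reval T (h \<circ> g) t" if "t \<in> rterms A" for t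
    using that h S.reval_closed[OF g]
    by (induction t) (auto simp: restr_hom_def mon_hom_def hom_def)
  obtain t where t: "t \<in> rterms A" "P = rcong A {} `` {t}"
    using P by (auto simp: rpres_carrier)
  have "rext S g P = reval S g t" "rext T (h \<circ> g) P = reval T (h \<circ> g) t"
    unfolding t(2) using t(1) by (intro S.rext_class[OF g] T.rext_class[OF hg]; simp)+
  with *[OF t(1)] show ?thesis by simp
qed

theorem admissible_satisfies:
  fixes X :: "'x set" and M :: "('m, 'k) monoid_scheme" and S :: "('s, 'l) restr_scheme"
  assumes adm: "admissible X (p, q)"
    and pq: "p \<in> carrier (FR_words X)" "q \<in> carrier (FR_words X)"
    and M: "monoid M" and S: "restriction_monoid S" and \<gamma>: "\<gamma> \<in> mon_hom M S"
  shows "satisfies X M S \<gamma> (p, q)"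
proof -
  interpret M: monoid M by fact
  interpret S: restriction_monoid S by fact
  define M0 :: "'x list monoid" where "M0 = \<lparr>carrier = lists X, mult = (@), one = []\<rparr>"
  interpret M0: monoid M0 by unfold_locales (auto simp: M0_def)
  define \<rho> where "\<rho> = {(RGen u \<cdot> RGen v, RGen (u @ v)) | u v. u \<in> lists X \<and> v \<in> lists X}
      \<union> {(RGen [] :: 'x list rterm, ROne)}"
  define S0 where "S0 = rpres (lists X) \<rho>"
  have S0: "restriction_monoid S0" unfolding S0_def by (rule rpres_restriction_monoid)
  define \<gamma>0 where "\<gamma>0 u = rcong (lists X) \<rho> `` {RGen u}" for u
  have "\<gamma>0 (u @ v) = \<gamma>0 u \<otimes>\<^bsub>S0\<^esub> \<gamma>0 v" if "u \<in> lists X" "v \<in> lists X" for u v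
  proof -
    have "(RGen u \<cdot> RGen v, RGen (u @ v)) \<in> \<rho>" using that by (auto simp: \<rho>_def)
    then show ?thesis
      using that unfolding \<gamma>0_def S0_def
      by (subst rpres_mult)
         (auto simp del: in_lists_conv_set simp: rclass_eq_iff intro!: rcong.sym[OF rcong.base])
  qed
  moreover have "\<gamma>0 [] = \<one>\<^bsub>S0\<^esub>"
    unfolding \<gamma>0_def S0_def rpres_one
    by (subst rclass_eq_iff) (auto intro!: rcong.base simp: \<rho>_def)
  ultimately have \<gamma>0: "\<gamma>0 \<in> mon_hom M0 S0"
    by (auto simp: mon_hom_def hom_def M0_def \<gamma>0_def S0_def rpres_carrier simp del: in_lists_conv_set)
  from adm S0 \<gamma>0 M0.monoid_axioms have sat0: "satisfies X M0 S0 \<gamma>0 (p, q)"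
    by (simp add: admissible_def)
  have wx: "word_ext M0 (\<lambda>x. [x]) u = u" for u :: "'x list"
    by (induction u) (auto simp: word_ext_def M0_def)
  then have "\<gamma>0 \<circ> word_ext M0 (\<lambda>x. [x]) = \<gamma>0" by auto
  moreover have "(\<lambda>x. [x]) \<in> X \<rightarrow> carrier M0" by (auto simp: M0_def)
  ultimately have eq0: "rext S0 \<gamma>0 p = rext S0 \<gamma>0 q"
    using sat0 unfolding satisfies_def ident_value_def by auto
  have \<gamma>0c: "\<gamma>0 \<in> lists X \<rightarrow> carrier S0"
    using \<gamma>0 by (auto simp: mon_hom_def hom_def M0_def)
  show ?thesis unfolding satisfies_def ident_value_def split
  proof
    fix f assume f: "f \<in> X \<rightarrow> carrier M"
    define g where "g = \<gamma> \<circ> word_ext M f"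
    have g: "g \<in> lists X \<rightarrow> carrier S"
    proof
      fix u assume "u \<in> lists X"
      then have "word_ext M f u \<in> carrier M" by (rule M.word_ext_closed[OF f])
      then show "g u \<in> carrier S" using \<gamma> by (auto simp: g_def mon_hom_def hom_def)
    qed
    have rels: "\<forall>(s, t)\<in>\<rho>. reval S g s = reval S g t"
    proof -
      have *: "g (u @ v) = g u \<otimes>\<^bsub>S\<^esub> g v" if "u \<in> lists X" "v \<in> lists X" for u v
      proof -
        have "word_ext M f u \<in> carrier M" "word_ext M f v \<in> carrier M"
          using M.word_ext_closed[OF f] that by blast+
        then show ?thesis
          using \<gamma> M.word_ext_append[OF f that] by (auto simp: g_def mon_hom_def hom_def)
      qed
      have "g [] = \<one>\<^bsub>S\<^esub>" using \<gamma> by (simp add: g_def mon_hom_def)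
      then show ?thesis by (auto simp: \<rho>_def intro!: *[symmetric])
    qed
    let ?h = "rext S g"
    have hgen: "?h (\<gamma>0 u) = g u" if "u \<in> lists X" for u
      unfolding \<gamma>0_def by (rule S.rext_morphism(2)[OF g rels that])
    have h: "?h \<in> restr_hom S0 S"
      unfolding S0_def by (rule S.rext_morphism(1)[OF g rels])
    have "rext S g P = ?h (rext S0 \<gamma>0 P)" if P: "P \<in> carrier (FR_words X)" for P
    proof -
      obtain t where t: "t \<in> rterms (lists X)" "P = rcong (lists X) {} `` {t}"
        using P by (auto simp: rpres_carrier)
      have c: "?h \<circ> \<gamma>0 \<in> lists X \<rightarrow> carrier S"
      proof
        fix u assume "u \<in> lists X"
        then show "(?h \<circ> \<gamma>0) u \<in> carrier S" using g hgen[of u] unfolding Pi_def comp_def by force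
      qed
      have "rext S (?h \<circ> \<gamma>0) P = reval S (?h \<circ> \<gamma>0) t" "rext S g P = reval S g t"
        unfolding t(2) using t(1) by (intro S.rext_class[OF c] S.rext_class[OF g]; simp)+
      moreover have "reval S (?h \<circ> \<gamma>0) t = reval S g t"
        by (rule reval_cong[OF _ t(1)]) (simp only: hgen comp_apply)
      ultimately have "rext S (?h \<circ> \<gamma>0) P = rext S g P" by simp
      then show ?thesis using restr_hom_rext[OF S0 S h \<gamma>0c P] by simp
    qed
    with pq eq0 show "rext S (\<gamma> \<circ> word_ext M f) p = rext S (\<gamma> \<circ> word_ext M f) q"
      unfolding g_def by metis
  qed
qed


subsection \<open>Inverse monoids\<close>

context inverse_monoid
begin

lemma sinv_props:
  assumes "x \<in> carrier S"
  shows "sinv S x \<in> carrier S" "x \<otimes> sinv S x \<otimes> x = x" "sinv S x \<otimes> x \<otimes> sinv S x = sinv S x"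
  using theI'[OF ex1_inverse[OF assms]] by (auto simp: sinv_def)

lemma sinv_eqI:
  "\<lbrakk>x \<in> carrier S; y \<in> carrier S; x \<otimes> y \<otimes> x = x; y \<otimes> x \<otimes> y = y\<rbrakk> \<Longrightarrow> sinv S x = y"
  using ex1_inverse[of x] sinv_props[of x] by blast

lemma sinv_sinv: "x \<in> carrier S \<Longrightarrow> sinv S (sinv S x) = x"
  using sinv_props by (intro sinv_eqI) auto

lemma sinv_idem: "\<lbrakk>e \<in> carrier S; e \<otimes> e = e\<rbrakk> \<Longrightarrow> sinv S e = e"
  by (intro sinv_eqI) auto

lemma sinv_mult_idem:
  assumes "x \<in> carrier S"
  shows "x \<otimes> sinv S x \<otimes> (x \<otimes> sinv S x) = x \<otimes> sinv S x"
    and "sinv S x \<otimes> x \<otimes> (sinv S x \<otimes> x) = sinv S x \<otimes> x"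
  using sinv_props[OF assms] assms by (metis m_assoc m_closed)+

lemma idem_mult_idem:
  assumes e: "e \<in> carrier S" "e \<otimes> e = e" and f: "f \<in> carrier S" "f \<otimes> f = f"
  shows "(e \<otimes> f) \<otimes> (e \<otimes> f) = e \<otimes> f"
proof -
  let ?a = "e \<otimes> f"
  define b where "b = sinv S ?a"
  have a: "?a \<in> carrier S" using e f by auto
  have b: "b \<in> carrier S" "?a \<otimes> b \<otimes> ?a = ?a" "b \<otimes> ?a \<otimes> b = b"
    using sinv_props[OF a] by (auto simp: b_def)
  let ?c = "f \<otimes> b \<otimes> e"
  have ee: "e \<otimes> (e \<otimes> z) = e \<otimes> z" and ff: "f \<otimes> (f \<otimes> z) = f \<otimes> z" if "z \<in> carrier S" for z
    using that e f by (metis m_assoc)+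
  have b': "e \<otimes> (f \<otimes> (b \<otimes> (e \<otimes> f))) = e \<otimes> f" "b \<otimes> (e \<otimes> (f \<otimes> b)) = b"
    using b e f by (simp_all add: m_assoc)
  have b'': "b \<otimes> (e \<otimes> (f \<otimes> (b \<otimes> z))) = b \<otimes> z" if "z \<in> carrier S" for z
  proof -
    have "b \<otimes> (e \<otimes> (f \<otimes> (b \<otimes> z))) = b \<otimes> (e \<otimes> (f \<otimes> b)) \<otimes> z"
      using that b(1) e(1) f(1) by (simp add: m_assoc)
    then show ?thesis using b' by simp
  qed
  have "sinv S ?a = ?c"
    using b(1) b' b'' e f by (intro sinv_eqI) (simp_all add: m_assoc ee ff)
  then have bc: "b = ?c" by (simp add: b_def)
  have "?c \<otimes> ?c = ?c"
    using b(1) b'' e f by (simp add: m_assoc ee ff)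
  then have "b \<otimes> b = b" using bc by simp
  then have "sinv S b = b" using b(1) by (rule sinv_idem[rotated])
  moreover have "sinv S b = ?a" using sinv_sinv[OF a] by (simp add: b_def)
  ultimately show ?thesis using \<open>b \<otimes> b = b\<close> by simp
qed

lemma idem_commute:
  assumes e: "e \<in> carrier S" "e \<otimes> e = e" and f: "f \<in> carrier S" "f \<otimes> f = f"
  shows "e \<otimes> f = f \<otimes> e"
proof -
  have ee: "e \<otimes> (e \<otimes> z) = e \<otimes> z" and ff: "f \<otimes> (f \<otimes> z) = f \<otimes> z" if "z \<in> carrier S" for z
    using that e f by (metis m_assoc)+
  have i1: "e \<otimes> (f \<otimes> (e \<otimes> f)) = e \<otimes> f" and i2: "f \<otimes> (e \<otimes> (f \<otimes> e)) = f \<otimes> e"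
    using idem_mult_idem[OF e f] idem_mult_idem[OF f e] e f by (simp_all add: m_assoc)
  have "sinv S (e \<otimes> f) = f \<otimes> e"
    using e f by (intro sinv_eqI) (simp_all add: m_assoc ee ff i1 i2)
  moreover have "sinv S (e \<otimes> f) = e \<otimes> f"
    using e f idem_mult_idem[OF e f] by (intro sinv_idem) auto
  ultimately show ?thesis by simp
qed

lemma sinv_mult:
  assumes x: "x \<in> carrier S" and y: "y \<in> carrier S"
  shows "sinv S (x \<otimes> y) = sinv S y \<otimes> sinv S x"
proof -
  let ?x = "sinv S x" and ?y = "sinv S y"
  note px = sinv_props[OF x] and py = sinv_props[OF y]
  have com: "(y \<otimes> ?y) \<otimes> (?x \<otimes> x) = (?x \<otimes> x) \<otimes> (y \<otimes> ?y)"
    using x y px py sinv_mult_idem by (intro idem_commute) auto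
  have "x \<otimes> y \<otimes> (?y \<otimes> ?x) \<otimes> (x \<otimes> y) = x \<otimes> ((y \<otimes> ?y) \<otimes> (?x \<otimes> x)) \<otimes> y"
    using x y px(1) py(1) by (simp add: m_assoc)
  also have "\<dots> = (x \<otimes> ?x \<otimes> x) \<otimes> (y \<otimes> ?y \<otimes> y)"
    unfolding com using x y px(1) py(1) by (simp add: m_assoc)
  finally have 1: "x \<otimes> y \<otimes> (?y \<otimes> ?x) \<otimes> (x \<otimes> y) = x \<otimes> y" using px py by simp
  have "(?y \<otimes> ?x) \<otimes> (x \<otimes> y) \<otimes> (?y \<otimes> ?x) = ?y \<otimes> ((?x \<otimes> x) \<otimes> (y \<otimes> ?y)) \<otimes> ?x"
    using x y px(1) py(1) by (simp add: m_assoc)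
  also have "\<dots> = (?y \<otimes> y \<otimes> ?y) \<otimes> (?x \<otimes> x \<otimes> ?x)"
    unfolding com[symmetric] using x y px(1) py(1) by (simp add: m_assoc)
  finally have 2: "(?y \<otimes> ?x) \<otimes> (x \<otimes> y) \<otimes> (?y \<otimes> ?x) = ?y \<otimes> ?x" using px py by simp
  show ?thesis using 1 2 x y px(1) py(1) by (intro sinv_eqI) auto
qed

lemma inv_restr_restriction_monoid: "restriction_monoid (inv_restr S)"
proof -
  note c = sinv_props(1) and m = sinv_mult and ss = sinv_sinv
  have P: "(x \<otimes> sinv S x) \<otimes> (y \<otimes> sinv S y) = (y \<otimes> sinv S y) \<otimes> (x \<otimes> sinv S x)"
    if "x \<in> carrier S" "y \<in> carrier S" for x y
    using that c sinv_mult_idem by (intro idem_commute) auto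
  have Q: "(sinv S x \<otimes> x) \<otimes> (sinv S y \<otimes> y) = (sinv S y \<otimes> y) \<otimes> (sinv S x \<otimes> x)"
    if "x \<in> carrier S" "y \<in> carrier S" for x y
    using that c sinv_mult_idem by (intro idem_commute) auto
  have PQ: "(x \<otimes> sinv S x) \<otimes> (sinv S y \<otimes> y) = (sinv S y \<otimes> y) \<otimes> (x \<otimes> sinv S x)"
    if "x \<in> carrier S" "y \<in> carrier S" for x y
    using that c sinv_mult_idem by (intro idem_commute) auto
  show ?thesis
  proof (unfold_locales, unfold inv_restr_def, simp_all add: c m ss m_assoc)
    fix x assume x: "x \<in> carrier S"
    show reg: "x \<otimes> (sinv S x \<otimes> x) = x" using x sinv_props[OF x] by (simp add: m_assoc)
    show "x \<otimes> (sinv S x \<otimes> x) = x" by (rule reg)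
    then show "x \<otimes> (sinv S x \<otimes> (x \<otimes> sinv S x)) = x \<otimes> sinv S x"
      using x c by (metis m_assoc m_closed)
    show "sinv S x \<otimes> (x \<otimes> (sinv S x \<otimes> x)) = sinv S x \<otimes> x"
      using sinv_mult_idem(2)[OF x] x c by (simp add: m_assoc)
  next
    fix x y assume x: "x \<in> carrier S" and y: "y \<in> carrier S"
    show "x \<otimes> (sinv S x \<otimes> (y \<otimes> sinv S y)) = y \<otimes> (sinv S y \<otimes> (x \<otimes> sinv S x))"
      using P[OF x y] x y c by (simp add: m_assoc)
    show "sinv S x \<otimes> (x \<otimes> (sinv S y \<otimes> y)) = sinv S y \<otimes> (y \<otimes> (sinv S x \<otimes> x))"
      using Q[OF x y] x y c by (simp add: m_assoc)
    let ?e = "x \<otimes> sinv S x"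
    have "x \<otimes> (sinv S x \<otimes> (y \<otimes> (sinv S y \<otimes> (x \<otimes> sinv S x)))) = ?e \<otimes> ((y \<otimes> sinv S y) \<otimes> ?e)"
      using x y c by (simp add: m_assoc)
    also have "\<dots> = (?e \<otimes> ?e) \<otimes> (y \<otimes> sinv S y)"
      unfolding P[OF x y, symmetric] using x y c by (simp add: m_assoc)
    also have "\<dots> = x \<otimes> (sinv S x \<otimes> (y \<otimes> sinv S y))"
      unfolding sinv_mult_idem(1)[OF x] using x y c by (simp add: m_assoc)
    finally show "x \<otimes> (sinv S x \<otimes> (y \<otimes> (sinv S y \<otimes> (x \<otimes> sinv S x))))
      = x \<otimes> (sinv S x \<otimes> (y \<otimes> sinv S y))" .
    let ?e = "sinv S y \<otimes> y"
    have "sinv S y \<otimes> (y \<otimes> (sinv S x \<otimes> (x \<otimes> (sinv S y \<otimes> y)))) = ?e \<otimes> ((sinv S x \<otimes> x) \<otimes> ?e)"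
      using x y c by (simp add: m_assoc)
    also have "\<dots> = (?e \<otimes> (sinv S x \<otimes> x)) \<otimes> ?e"
      using x y c by (simp add: m_assoc)
    also have "\<dots> = (sinv S x \<otimes> x) \<otimes> (?e \<otimes> ?e)"
      unfolding Q[OF y x] using x y c by (simp add: m_assoc)
    also have "\<dots> = sinv S x \<otimes> (x \<otimes> (sinv S y \<otimes> y))"
      unfolding sinv_mult_idem(2)[OF y] using x y c by (simp add: m_assoc)
    finally show "sinv S y \<otimes> (y \<otimes> (sinv S x \<otimes> (x \<otimes> (sinv S y \<otimes> y))))
      = sinv S x \<otimes> (x \<otimes> (sinv S y \<otimes> y))" .
    have "x \<otimes> (y \<otimes> (sinv S y \<otimes> (sinv S x \<otimes> x))) = x \<otimes> ((y \<otimes> sinv S y) \<otimes> (sinv S x \<otimes> x))"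
      using x y c by (simp add: m_assoc)
    also have "\<dots> = (x \<otimes> sinv S x \<otimes> x) \<otimes> (y \<otimes> sinv S y)"
      unfolding PQ[OF y x] using x y c by (simp add: m_assoc)
    finally show "x \<otimes> (y \<otimes> sinv S y) = x \<otimes> (y \<otimes> (sinv S y \<otimes> (sinv S x \<otimes> x)))"
      using sinv_props[OF x] by simp
    have "y \<otimes> (sinv S y \<otimes> (sinv S x \<otimes> (x \<otimes> y))) = ((y \<otimes> sinv S y) \<otimes> (sinv S x \<otimes> x)) \<otimes> y"
      using x y c by (simp add: m_assoc)
    also have "\<dots> = (sinv S x \<otimes> x) \<otimes> (y \<otimes> sinv S y \<otimes> y)"
      unfolding PQ[OF y x] using x y c by (simp add: m_assoc)
    finally show "sinv S x \<otimes> (x \<otimes> y) = y \<otimes> (sinv S y \<otimes> (sinv S x \<otimes> (x \<otimes> y)))"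
      using sinv_props[OF y] x y c by (simp add: m_assoc)
  qed
qed

lemma proj_inv_restr: "proj (inv_restr S) = idems S"
proof
  show "proj (inv_restr S) \<subseteq> idems S"
    using sinv_props sinv_mult_idem by (auto simp: proj_def inv_restr_def idems_def)
  show "idems S \<subseteq> proj (inv_restr S)"
    by (auto simp: proj_def inv_restr_def idems_def sinv_idem intro!: image_eqI)
qed

end

lemma iterms_simps [simp]:
  "IGen a \<in> iterms A \<longleftrightarrow> a \<in> A" "IOne \<in> iterms A"
  "s \<odot> t \<in> iterms A \<longleftrightarrow> s \<in> iterms A \<and> t \<in> iterms A"
  "IInv s \<in> iterms A \<longleftrightarrow> s \<in> iterms A"
  by (auto simp: iterms_def)

lemma icong_iterms: "(s, t) \<in> icong A \<rho> \<Longrightarrow> s \<in> iterms A \<and> t \<in> iterms A"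
  by (induction rule: icong.induct) auto

lemma equiv_icong: "equiv (iterms A) (icong A \<rho>)"
  by (rule equivI)
     (auto simp: refl_on_def sym_def trans_def dest: icong_iterms intro: icong.refl icong.sym icong.trans)

lemma iclass_eq_iff:
  "\<lbrakk>s \<in> iterms A; t \<in> iterms A\<rbrakk> \<Longrightarrow>
     icong A \<rho> `` {s} = icong A \<rho> `` {t} \<longleftrightarrow> (s, t) \<in> icong A \<rho>"
  using eq_equiv_class_iff[OF equiv_icong] by metis

lemma iclass_eqI: "(s, t) \<in> icong A \<rho> \<Longrightarrow> icong A \<rho> `` {s} = icong A \<rho> `` {t}"
  by (rule equiv_class_eq[OF equiv_icong])

lemma ipres_carrier: "carrier (ipres A \<rho>) = (\<lambda>s. icong A \<rho> `` {s}) ` iterms A"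
  by (auto simp: ipres_def quotient_def)

lemma ipres_one: "\<one>\<^bsub>ipres A \<rho>\<^esub> = icong A \<rho> `` {IOne}"
  by (simp add: ipres_def)

lemma ipres_mult:
  assumes "s \<in> iterms A" "t \<in> iterms A"
  shows "(icong A \<rho> `` {s}) \<otimes>\<^bsub>ipres A \<rho>\<^esub> (icong A \<rho> `` {t}) = icong A \<rho> `` {s \<odot> t}"
proof -
  have "congruent2 (icong A \<rho>) (icong A \<rho>) (\<lambda>s t. icong A \<rho> `` {s \<odot> t})"
    by (auto simp: congruent2_def intro!: iclass_eqI icong.mult)
  from UN_equiv_class2[OF equiv_icong equiv_icong this assms] show ?thesis
    by (simp add: ipres_def)
qed

lemma ipres_monoid: "monoid (ipres A \<rho>)"
  by unfold_locales
     (auto simp: ipres_carrier ipres_one ipres_mult del: equalityI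
           intro!: iclass_eqI icong.base UnI1 intro: inv_laws.intros)

lemma (in monoid) inverse_monoidI:
  assumes j: "\<And>x. x \<in> carrier G \<Longrightarrow> j x \<in> carrier G"
    and reg: "\<And>x. x \<in> carrier G \<Longrightarrow> x \<otimes> j x \<otimes> x = x"
    and jj: "\<And>x. x \<in> carrier G \<Longrightarrow> j (j x) = x"
    and jm: "\<And>x y. \<lbrakk>x \<in> carrier G; y \<in> carrier G\<rbrakk> \<Longrightarrow> j (x \<otimes> y) = j y \<otimes> j x"
    and com: "\<And>x y. \<lbrakk>x \<in> carrier G; y \<in> carrier G\<rbrakk>
      \<Longrightarrow> x \<otimes> j x \<otimes> (y \<otimes> j y) = y \<otimes> j y \<otimes> (x \<otimes> j x)"
  shows "inverse_monoid G"
proof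
  fix x assume x: "x \<in> carrier G"
  have reg': "j y \<otimes> y \<otimes> j y = j y" if "y \<in> carrier G" for y
    using reg[of "j y"] that by (simp add: j jj)
  have idem: "e = e \<otimes> j e" if e: "e \<in> carrier G" "e \<otimes> e = e" for e
  proof -
    have je: "j e \<in> carrier G" "j e \<otimes> j e = j e" using e jm[of e e] by (auto simp: j)
    have "j e = j e \<otimes> (e \<otimes> e) \<otimes> j e" using reg'[of e] e by simp
    also have "\<dots> = (j e \<otimes> e) \<otimes> (e \<otimes> j e)" 
      using e(1) je(1) by (simp only: m_assoc m_closed)
    also have "\<dots> = (e \<otimes> j e) \<otimes> (j e \<otimes> e)" using com[of "j e" e] e je by (simp add: jj)
    also have "\<dots> = e \<otimes> (j e \<otimes> j e) \<otimes> e" using e(1) je(1) by (simp add: m_assoc)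
    also have "\<dots> = e" using e je reg[of e] by simp
    finally show ?thesis using e by simp
  qed
  have ic: "e \<otimes> f = f \<otimes> e"
    if "e \<in> carrier G" "e \<otimes> e = e" "f \<in> carrier G" "f \<otimes> f = f" for e f
    using com[of e f] idem[of e] idem[of f] that by simp
  show "\<exists>!y. y \<in> carrier G \<and> x \<otimes> y \<otimes> x = x \<and> y \<otimes> x \<otimes> y = y"
  proof (rule ex1I[of _ "j x"])
    show "j x \<in> carrier G \<and> x \<otimes> j x \<otimes> x = x \<and> j x \<otimes> x \<otimes> j x = j x"
      using x by (simp add: j reg reg')
  next
    fix y assume y: "y \<in> carrier G \<and> x \<otimes> y \<otimes> x = x \<and> y \<otimes> x \<otimes> y = y"
    let ?z = "j x"
    have z: "?z \<in> carrier G" "x \<otimes> ?z \<otimes> x = x" "?z \<otimes> x \<otimes> ?z = ?z"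
      using x by (simp_all add: j reg reg')
    have i: "(y \<otimes> x) \<otimes> (?z \<otimes> x) = (?z \<otimes> x) \<otimes> (y \<otimes> x)"
            "(x \<otimes> y) \<otimes> (x \<otimes> ?z) = (x \<otimes> ?z) \<otimes> (x \<otimes> y)"
      using x y z by (intro ic; simp; metis m_assoc m_closed)+
    have "y = y \<otimes> (x \<otimes> ?z \<otimes> x) \<otimes> y" using y z by simp
    also have "\<dots> = ((y \<otimes> x) \<otimes> (?z \<otimes> x)) \<otimes> y" using x y z(1) by (simp add: m_assoc)
    also have "\<dots> = ?z \<otimes> (x \<otimes> y \<otimes> x) \<otimes> y" unfolding i using x y z(1) by (simp add: m_assoc)
    also have "\<dots> = ?z \<otimes> (x \<otimes> ?z \<otimes> x) \<otimes> y" using y z by simp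
    also have "\<dots> = ?z \<otimes> ((x \<otimes> ?z) \<otimes> (x \<otimes> y))" using x y z(1) by (simp add: m_assoc)
    also have "\<dots> = ?z \<otimes> (x \<otimes> y \<otimes> x) \<otimes> ?z" unfolding i[symmetric]
      using x conjunct1[OF y] z(1) by (simp only: m_assoc m_closed)
    also have "\<dots> = ?z" using y z by simp
    finally show "y = ?z" .
  qed
qed

lemma ipres_inverse_monoid: "inverse_monoid (ipres A \<rho>)"
  and ipres_sinv: "s \<in> iterms A \<Longrightarrow> sinv (ipres A \<rho>) (icong A \<rho> `` {s}) = icong A \<rho> `` {IInv s}"
proof -
  interpret monoid "ipres A \<rho>" by (rule ipres_monoid)
  define j where "j P = (\<Union>s\<in>P. icong A \<rho> `` {IInv s})" for P
  have j: "j (icong A \<rho> `` {s}) = icong A \<rho> `` {IInv s}" if "s \<in> iterms A" for s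
  proof -
    have "congruent (icong A \<rho>) (\<lambda>s. icong A \<rho> `` {IInv s})"
      by (auto simp: congruent_def intro!: iclass_eqI icong.inv)
    from UN_equiv_class[OF equiv_icong this that] show ?thesis by (simp add: j_def)
  qed
  have law: "icong A \<rho> `` {s} = icong A \<rho> `` {t}"
    if "(s, t) \<in> inv_laws" "s \<in> iterms A" "t \<in> iterms A" for s t
    using that by (auto simp: iclass_eq_iff intro: icong.base)
  show inv: "inverse_monoid (ipres A \<rho>)"
    by (rule inverse_monoidI[of j])
       (auto simp: ipres_carrier ipres_mult j del: equalityI intro!: law inv_laws.intros)
  interpret inverse_monoid "ipres A \<rho>" by (rule inv)
  show "sinv (ipres A \<rho>) (icong A \<rho> `` {s}) = icong A \<rho> `` {IInv s}" if s: "s \<in> iterms A"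
  proof (rule sinv_eqI)
    have "(IInv s \<odot> IInv (IInv s) \<odot> IInv s, IInv s) \<in> icong A \<rho>"
      using s by (auto intro!: icong.base inv_laws.intros)
    moreover have "(IInv s \<odot> IInv (IInv s) \<odot> IInv s, IInv s \<odot> s \<odot> IInv s) \<in> icong A \<rho>"
      using s by (auto intro!: icong.mult icong.refl icong.base inv_laws.intros)
    ultimately have "(IInv s \<odot> s \<odot> IInv s, IInv s) \<in> icong A \<rho>"
      using icong.sym icong.trans by blast
    then show "icong A \<rho> `` {IInv s} \<otimes>\<^bsub>ipres A \<rho>\<^esub> icong A \<rho> `` {s} \<otimes>\<^bsub>ipres A \<rho>\<^esub> icong A \<rho> `` {IInv s}
      = icong A \<rho> `` {IInv s}"
      using s by (simp add: ipres_mult iclass_eq_iff)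
  qed (use s in \<open>auto simp: ipres_carrier ipres_mult del: equalityI
           intro!: law inv_laws.intros\<close>)
qed

lemma (in inverse_monoid) ieval_closed:
  assumes "g \<in> A \<rightarrow> carrier S" "t \<in> iterms A"
  shows "ieval S g t \<in> carrier S"
  using assms(2) by (induction t) (use assms(1) in \<open>auto intro: sinv_props\<close>)

lemma (in inverse_monoid) ieval_laws:
  assumes g: "g \<in> A \<rightarrow> carrier S" and "(s, t) \<in> inv_laws" "s \<in> iterms A" "t \<in> iterms A"
  shows "ieval S g s = ieval S g t"
  using assms(2-4)
proof (cases rule: inv_laws.cases)
  case (7 s t)
  then show ?thesis
    using assms(3) by (auto intro!: idem_commute simp: ieval_closed[OF g] sinv_props(1) sinv_mult_idem)
qed (simp_all add: ieval_closed[OF g] sinv_props sinv_sinv sinv_mult,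
     simp add: ieval_closed[OF g] m_assoc)

lemma (in inverse_monoid) ieval_icong:
  assumes g: "g \<in> A \<rightarrow> carrier S"
    and rels: "\<forall>(s, t)\<in>\<rho>. ieval S g s = ieval S g t"
    and st: "(s, t) \<in> icong A \<rho>"
  shows "ieval S g s = ieval S g t"
  using st
proof (induction rule: icong.induct)
  case (base s t)
  then consider "(s, t) \<in> inv_laws" | "(s, t) \<in> \<rho>" by blast
  then show ?case using rels base by cases (auto intro: ieval_laws[OF g])
qed simp_all

lemma (in inverse_monoid) iext_class:
  assumes g: "g \<in> A \<rightarrow> carrier S"
    and rels: "\<forall>(s, t)\<in>\<rho>. ieval S g s = ieval S g t"
    and s: "s \<in> iterms A"
  shows "iext S g (icong A \<rho> `` {s}) = ieval S g s"
proof -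
  have "ieval S g ` (icong A \<rho> `` {s}) = (\<lambda>_. ieval S g s) ` (icong A \<rho> `` {s})"
    by (rule image_cong[OF HOL.refl], rule ieval_icong[OF g rels, symmetric]) simp
  moreover have "icong A \<rho> `` {s} \<noteq> {}"
    using icong.refl[OF s, of \<rho>] by blast
  ultimately show ?thesis by (simp add: iext_def image_constant_conv)
qed

lemma (in inverse_monoid) iext_morphism:
  assumes g: "g \<in> A \<rightarrow> carrier S"
    and rels: "\<forall>(s, t)\<in>\<rho>. ieval S g s = ieval S g t"
  shows "iext S g \<in> mon_hom (ipres A \<rho>) S"
    and "a \<in> A \<Longrightarrow> iext S g (icong A \<rho> `` {IGen a}) = g a"
  by (auto simp: mon_hom_def hom_def ipres_carrier ipres_one ipres_mult
        iext_class[OF g rels] ieval_closed[OF g])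

end

theory Submission
  imports Defs
begin

text \<open>
  Let \<open>\<pi>\<close> be the canonical morphism \<open>\<lfloor>m\<rfloor> \<mapsto> [m]\<close> and \<open>\<sigma>\<close> the morphism \<open>\<lfloor>m\<rfloor> \<mapsto> m\<close> to \<open>M\<close> with
  trivial \<open>\<^sup>*\<close> and \<open>\<^sup>+\<close>, which exists because the identities are admissible.  Then \<open>\<eta>\<close> is the map
  \<open>P \<mapsto> (\<pi> P\<^sup>+, \<sigma> P)\<close>: it is multiplicative because \<open>\<pi> P \<le> [\<sigma> P]\<close>.  Since \<open>P = P\<^sup>+ \<lfloor>\<sigma> P\<rfloor>\<close>, it is
  injective as soon as \<open>\<pi>\<close> is injective on projections.  That holds because the Munn
  representation of a restriction monoid \<open>S\<close> by partial injections of \<open>P(S)\<close> separates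
  projections and, for the universal \<open>S\<close>, factors through \<open>\<pi>\<close>.
\<close>

section \<open>Restriction monoids and the Munn representation\<close>

text \<open>Injectivity identifies two points with a common image. Hence the idempotents
  \<open>r O r\<inverse>\<close> of a symmetric inverse monoid are partial identities, which
  commute.\<close>

lemma relcomp_converse_Id_on:
  assumes "single_valued (r\<inverse>)"
  shows "r O r\<inverse> = Id_on (Domain r)"
proof -
  have "x = z" if "(x, y) \<in> r" "(z, y) \<in> r" for x y z
    using single_valuedD[OF assms, of y x z] that by simp
  then show ?thesis by blast
qed

lemma single_valued_relcomp_converse:
  assumes "single_valued r"
  shows "r O r\<inverse> O r = r"
proof (intro equalityI subrelI)
  fix x z assume "(x, z) \<in> r O r\<inverse> O r"
  then obtain y u where "(x, y) \<in> r" "(u, y) \<in> r" "(u, z) \<in> r" by blast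
  then show "(x, z) \<in> r" using single_valuedD[OF assms, of u y z] by simp
qed blast

context restriction_monoid
begin

section \<open>Projections and the natural partial order\<close>

lemma proj_cases:
  assumes "e \<in> proj S"
  shows "e \<in> carrier S" "rplus S e = e" "rstar S e = e" "e \<otimes> e = e"
proof -
  obtain x where x: "x \<in> carrier S" "e = rstar S x"
    using assms by (auto simp: proj_def)
  show 1: "e \<in> carrier S" "rplus S e = e" using x by (simp_all add: plus_star)
  then show "rstar S e = e" using star_plus[of e] by simp
  show "e \<otimes> e = e" using plus_left_id[of e] 1 by simp
qed

lemma star_proj [simp]: "x \<in> carrier S \<Longrightarrow> rstar S x \<in> proj S"
  by (simp add: proj_def)

lemma plus_proj [simp]: "x \<in> carrier S \<Longrightarrow> rplus S x \<in> proj S"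
  unfolding proj_def by (rule image_eqI[of _ _ "rplus S x"]) (simp_all add: star_plus)

lemma proj_commute: "\<lbrakk>e \<in> proj S; f \<in> proj S\<rbrakk> \<Longrightarrow> e \<otimes> f = f \<otimes> e"
  using plus_comm[of e f] by (simp add: proj_cases)

lemma proj_mult_closed: "\<lbrakk>e \<in> proj S; f \<in> proj S\<rbrakk> \<Longrightarrow> e \<otimes> f \<in> proj S"
  using plus_plus_mult[of e f] plus_proj[of "e \<otimes> f"] by (simp add: proj_cases)

lemma one_proj [simp]: "\<one> \<in> proj S"
  using star_right_id[of \<one>] star_proj[of \<one>] by simp

lemma plus_proj_mult: "\<lbrakk>e \<in> proj S; x \<in> carrier S\<rbrakk> \<Longrightarrow> rplus S (e \<otimes> x) = e \<otimes> rplus S x"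
  using plus_plus_mult[of e x] by (simp add: proj_cases)

lemma star_mult_proj: "\<lbrakk>e \<in> proj S; x \<in> carrier S\<rbrakk> \<Longrightarrow> rstar S (x \<otimes> e) = rstar S x \<otimes> e"
  using star_mult_star[of x e] by (simp add: proj_cases)

lemma proj_mult_swap: "\<lbrakk>e \<in> proj S; x \<in> carrier S\<rbrakk> \<Longrightarrow> x \<otimes> e = rplus S (x \<otimes> e) \<otimes> x"
  using plus_ample[of x e] by (simp add: proj_cases)

lemma mult_proj_swap: "\<lbrakk>e \<in> proj S; x \<in> carrier S\<rbrakk> \<Longrightarrow> e \<otimes> x = x \<otimes> rstar S (e \<otimes> x)"
  using star_ample[of e x] by (simp add: proj_cases)

text \<open>The ample identity turns the left side into \<open>(x y)\<^sup>+ x\<^sup>+\<close>, and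
  \<open>x\<^sup>+\<close> is absorbed because \<open>x\<^sup>+ x = x\<close>.\<close>

lemma plus_mult_plus:
  assumes x: "x \<in> carrier S" and y: "y \<in> carrier S"
  shows "rplus S (x \<otimes> rplus S y) = rplus S (x \<otimes> y)"
proof -
  have "rplus S (x \<otimes> rplus S y) = rplus S (rplus S (x \<otimes> y) \<otimes> x)"
    by (rule arg_cong[OF plus_ample[OF x y]])
  also have "\<dots> = rplus S x \<otimes> rplus S (x \<otimes> y)"
    using x y by (simp add: plus_plus_mult plus_comm)
  also have "\<dots> = rplus S (rplus S x \<otimes> x \<otimes> y)"
    using x y by (simp only: plus_plus_mult m_assoc plus_closed m_closed)
  finally show ?thesis using x by (simp add: plus_left_id)
qed

lemma star_star_mult:
  assumes x: "x \<in> carrier S" and y: "y \<in> carrier S"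
  shows "rstar S (rstar S x \<otimes> y) = rstar S (x \<otimes> y)"
proof -
  have "rstar S (rstar S x \<otimes> y) = rstar S (y \<otimes> rstar S (x \<otimes> y))"
    by (rule arg_cong[OF star_ample[OF x y]])
  also have "\<dots> = rstar S (x \<otimes> y) \<otimes> rstar S y"
    using x y by (simp add: star_mult_star star_comm)
  also have "\<dots> = rstar S (x \<otimes> (y \<otimes> rstar S y))"
    using x y by (simp only: star_mult_star m_assoc[symmetric] star_closed m_closed)
  finally show ?thesis using y by (simp add: star_right_id)
qed

text \<open>The witness can always be \<open>s\<^sup>+\<close>: from \<open>s = e t\<close> follow
  \<open>s\<^sup>+ = e t\<^sup>+\<close> and \<open>s\<^sup>+ t = e t = s\<close>. This replaces the
  existential by an equation.\<close>

lemma nat_le_iff_plus: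
  assumes "s \<in> carrier S" "t \<in> carrier S"
  shows "nat_le S s t \<longleftrightarrow> s = rplus S s \<otimes> t"
proof
  assume "nat_le S s t"
  then obtain e where e: "e \<in> proj S" "s = e \<otimes> t" by (auto simp: nat_le_def)
  have "rplus S s \<otimes> t = e \<otimes> (rplus S t \<otimes> t)"
    using e assms by (simp add: plus_proj_mult m_assoc proj_cases)
  then show "s = rplus S s \<otimes> t" using e assms by (simp add: plus_left_id)
qed (use assms in \<open>auto simp: nat_le_def\<close>)

lemma nat_le_proj_mult: "e \<in> proj S \<Longrightarrow> nat_le S (e \<otimes> t) t"
  by (auto simp: nat_le_def)

lemma nat_le_mult_proj: "\<lbrakk>e \<in> proj S; t \<in> carrier S\<rbrakk> \<Longrightarrow> nat_le S (t \<otimes> e) t"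
  unfolding nat_le_def
  by (rule bexI[of _ "rplus S (t \<otimes> e)"]) (simp_all add: proj_mult_swap[symmetric] proj_cases)

text \<open>Projections can be moved through \<open>t\<close> to the other side, so the order is
  left-right symmetric.\<close>

lemma nat_le_iff_star:
  assumes "s \<in> carrier S" "t \<in> carrier S"
  shows "nat_le S s t \<longleftrightarrow> s = t \<otimes> rstar S s"
proof
  assume "nat_le S s t"
  then obtain e where "e \<in> proj S" "s = e \<otimes> t" by (auto simp: nat_le_def)
  then show "s = t \<otimes> rstar S s" using assms mult_proj_swap[of e t] by simp
next
  assume "s = t \<otimes> rstar S s"
  then show "nat_le S s t" using nat_le_mult_proj[of "rstar S s" t] assms by simp
qed

lemma nat_le_refl [simp]: "t \<in> carrier S \<Longrightarrow> nat_le S t t"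
  by (simp add: nat_le_iff_plus plus_left_id)

lemma nat_le_trans:
  assumes "nat_le S r s" "nat_le S s t" "t \<in> carrier S"
  shows "nat_le S r t"
proof -
  obtain e f where "e \<in> proj S" "r = e \<otimes> s" "f \<in> proj S" "s = f \<otimes> t"
    using assms by (auto simp: nat_le_def)
  then show ?thesis
    using nat_le_proj_mult[of "e \<otimes> f" t] assms(3) by (simp add: proj_mult_closed m_assoc proj_cases)
qed

text \<open>Writing \<open>s = s\<^sup>+ t\<close> and \<open>u = v u\<^sup>*\<close> puts the
  projections on the outside of \<open>t v\<close>.\<close>

lemma nat_le_mult_mono:
  assumes "nat_le S s t" "nat_le S u v"
    and c: "s \<in> carrier S" "t \<in> carrier S" "u \<in> carrier S" "v \<in> carrier S"
  shows "nat_le S (s \<otimes> u) (t \<otimes> v)"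
proof -
  have "s \<otimes> u = (rplus S s \<otimes> t) \<otimes> (v \<otimes> rstar S u)"
    using assms nat_le_iff_plus[of s t] nat_le_iff_star[of u v] by metis
  also have "\<dots> = rplus S s \<otimes> ((t \<otimes> v) \<otimes> rstar S u)"
    using c by (simp add: m_assoc)
  finally have "nat_le S (s \<otimes> u) ((t \<otimes> v) \<otimes> rstar S u)"
    using nat_le_proj_mult c by simp
  then show ?thesis
    using nat_le_trans nat_le_mult_proj c by (meson m_closed star_proj)
qed

lemma nat_le_plus:
  assumes "nat_le S s t" "s \<in> carrier S" "t \<in> carrier S"
  shows "nat_le S (rplus S s) (rplus S t)"
proof -
  have "rplus S s = rplus S (rplus S s \<otimes> t)"
    using assms nat_le_iff_plus[of s t] by metis
  also have "\<dots> = rplus S s \<otimes> rplus S t" using assms by (simp add: plus_plus_mult)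
  finally show ?thesis using assms nat_le_proj_mult[of "rplus S s" "rplus S t"] by simp
qed

lemma nat_le_star:
  assumes "nat_le S s t" "s \<in> carrier S" "t \<in> carrier S"
  shows "nat_le S (rstar S s) (rstar S t)"
proof -
  have "rstar S s = rstar S (t \<otimes> rstar S s)"
    using assms nat_le_iff_star[of s t] by metis
  also have "\<dots> = rstar S t \<otimes> rstar S s" using assms by (simp add: star_mult_star)
  finally show ?thesis using assms nat_le_mult_proj[of "rstar S s" "rstar S t"] by simp
qed

lemma nat_le_proj:
  assumes "nat_le S s e" "e \<in> proj S"
  shows "s \<in> proj S"
  using assms by (auto simp: nat_le_def intro: proj_mult_closed)

lemma nat_le_proj_antisym:
  assumes "nat_le S e f" "nat_le S f e" "e \<in> proj S" "f \<in> proj S"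
  shows "e = f"
  using assms nat_le_iff_plus[of e f] nat_le_iff_plus[of f e] proj_commute[of e f]
  by (simp add: proj_cases)

text \<open>The Munn representation.  An element \<open>s\<close> acts by \<open>(s e)\<^sup>+ \<mapsto> e\<close> for projections
  \<open>e \<le> s\<^sup>*\<close>; writing \<open>t = s e\<close> makes the description left-right symmetric.\<close>

definition munn :: "'a \<Rightarrow> 'a rel" where
  "munn s = {(rplus S t, rstar S t) | t. t \<in> carrier S \<and> nat_le S t s}"

lemma munnI:
  "\<lbrakk>t \<in> carrier S; nat_le S t s; a = rplus S t; b = rstar S t\<rbrakk> \<Longrightarrow> (a, b) \<in> munn s"
  by (auto simp: munn_def)

text \<open>Whatever lies below a projection is a projection and so equals its own
  \<open>rplus\<close> and \<open>rstar\<close>.\<close>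

lemma munn_proj:
  assumes "e \<in> proj S"
  shows "munn e = Id_on {f \<in> proj S. nat_le S f e}"
proof (intro equalityI subrelI)
  fix a b assume "(a, b) \<in> munn e"
  then obtain t where "nat_le S t e" "a = rplus S t" "b = rstar S t" by (auto simp: munn_def)
  then show "(a, b) \<in> Id_on {f \<in> proj S. nat_le S f e}"
    using nat_le_proj[of t e] assms by (auto simp: proj_cases)
next
  fix a b assume "(a, b) \<in> Id_on {f \<in> proj S. nat_le S f e}"
  then show "(a, b) \<in> munn e" by (auto simp: proj_cases intro: munnI[of a])
qed

text \<open>A projection \<open>e\<close> is recovered as the greatest element of the domain of
  \<open>munn e\<close>.\<close>

lemma munn_inj_on_proj: "inj_on munn (proj S)"
proof
  fix e f assume "e \<in> proj S" "f \<in> proj S" "munn e = munn f"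
  moreover from this have "(e, e) \<in> munn f" "(f, f) \<in> munn e"
    by (auto simp: munn_proj proj_cases Id_on_def)
  ultimately show "e = f" by (auto simp: munn_proj intro: nat_le_proj_antisym)
qed

lemma munn_mult:
  assumes s: "s \<in> carrier S" and v: "v \<in> carrier S"
  shows "munn (s \<otimes> v) = munn s O munn v"
proof (intro equalityI subrelI)
  fix x z assume "(x, z) \<in> munn (s \<otimes> v)"
  then obtain w where w: "w \<in> carrier S" "nat_le S w (s \<otimes> v)" "x = rplus S w" "z = rstar S w"
    by (auto simp: munn_def)
  \<comment> \<open>An element \<open>w\<close> below \<open>s v\<close> has to be split as
    \<open>t u\<close> with \<open>t\<close> below \<open>s\<close>, \<open>u\<close> below
    \<open>v\<close> and matching ends \<open>t\<^sup>* = u\<^sup>+\<close>. The factor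
    \<open>v\<^sup>+\<close> cuts \<open>t\<^sup>*\<close> down to the part where \<open>v\<close>
    acts, and \<open>t\<^sup>*\<close> then cuts \<open>v\<close> down to \<open>u\<close>.\<close>
  let ?t = "rplus S w \<otimes> s \<otimes> rplus S v"
  let ?u = "rstar S ?t \<otimes> v"
  have c: "?t \<in> carrier S" using s v w by simp
  have tv: "?t \<otimes> v = w"
    using s v w nat_le_iff_plus[of w "s \<otimes> v"] by (simp add: m_assoc plus_left_id)
  have ws: "rplus S w \<otimes> (s \<otimes> v) = w"
    using w s v nat_le_iff_plus[of w "s \<otimes> v"] by simp
  have "nat_le S ?t s"
    using s v w by (simp add: m_assoc)
      (meson nat_le_proj_mult nat_le_mult_proj nat_le_trans plus_closed plus_proj m_closed)
  moreover have "nat_le S ?u v"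
    using c by (simp add: nat_le_proj_mult)
  moreover have "rplus S ?t = x"
    using s v w tv plus_mult_plus[of "rplus S w \<otimes> s" "rplus S v"] plus_mult_plus[OF c v]
      plus_mult_plus[of "rplus S w \<otimes> s" v]
    by (simp add: m_assoc ws)
  moreover have "rplus S ?u = rstar S ?t"
  proof -
    have "?t \<otimes> rplus S v = ?t"
      using s v w by (simp add: m_assoc proj_cases)
    moreover have "rplus S ?u = rstar S ?t \<otimes> rplus S v"
      using c v by (simp add: plus_proj_mult)
    moreover have "rstar S (?t \<otimes> rplus S v) = rstar S ?t \<otimes> rplus S v"
      using c v by (simp add: star_mult_proj)
    ultimately show ?thesis by simp
  qed
  moreover have "rstar S ?u = z"
    using c v w tv by (simp add: star_star_mult)
  ultimately have "(x, rstar S ?t) \<in> munn s" "(rstar S ?t, z) \<in> munn v"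
    using c v by (auto intro: munnI[of ?t] munnI[of ?u])
  then show "(x, z) \<in> munn s O munn v" by blast
next
  fix x z assume "(x, z) \<in> munn s O munn v"
  then obtain t u where tu: "t \<in> carrier S" "nat_le S t s" "u \<in> carrier S" "nat_le S u v"
      "x = rplus S t" "rstar S t = rplus S u" "z = rstar S u"
    by (auto simp: munn_def)
  have "rplus S (t \<otimes> u) = x"
    using tu plus_mult_plus[of t u] star_right_id[of t] by simp
  moreover have "rstar S (t \<otimes> u) = z"
    using tu star_star_mult[of t u] plus_left_id[of u] by simp
  moreover have "nat_le S (t \<otimes> u) (s \<otimes> v)"
    using tu s v by (intro nat_le_mult_mono)
  ultimately show "(x, z) \<in> munn (s \<otimes> v)"
    using tu by (auto intro: munnI[of "t \<otimes> u"])
qed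

text \<open>An element \<open>t\<close> below \<open>s\<close> is determined by
  \<open>t\<^sup>+\<close>, since \<open>t = t\<^sup>+ s\<close>; dually it is determined by
  \<open>t\<^sup>*\<close>, which gives the statement for the converse.\<close>

lemma single_valued_munn: "s \<in> carrier S \<Longrightarrow> single_valued (munn s)"
  unfolding single_valued_def munn_def by clarsimp (metis nat_le_iff_plus)

lemma single_valued_munn_converse: "s \<in> carrier S \<Longrightarrow> single_valued ((munn s)\<inverse>)"
  unfolding single_valued_def munn_def by clarsimp (metis nat_le_iff_star)

lemma munnE:
  assumes "(a, b) \<in> munn s"
  obtains t where "t \<in> carrier S" "nat_le S t s" "a = rplus S t" "b = rstar S t"
  using assms by (auto simp: munn_def)

text \<open>Both sides are partial identities, so only domains are compared: a projection
  \<open>f\<close> below \<open>s\<^sup>+\<close> is \<open>(f s)\<^sup>+\<close>, and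
  \<open>f s\<close> lies below \<open>s\<close>.\<close>

lemma munn_plus:
  assumes s: "s \<in> carrier S"
  shows "munn (rplus S s) = munn s O (munn s)\<inverse>"
proof -
  have "{f \<in> proj S. nat_le S f (rplus S s)} = Domain (munn s)"
  proof (intro equalityI subsetI)
    fix f assume "f \<in> {f \<in> proj S. nat_le S f (rplus S s)}"
    then have f: "f \<in> proj S" "nat_le S f (rplus S s)" by simp_all
    have "f = rplus S (f \<otimes> s)"
      using f s nat_le_iff_plus[of f "rplus S s"] by (simp add: plus_proj_mult proj_cases)
    then have "(f, rstar S (f \<otimes> s)) \<in> munn s"
      using f s proj_cases(1)[of f] by (intro munnI[of "f \<otimes> s"]) (simp_all add: nat_le_proj_mult)
    then show "f \<in> Domain (munn s)" by (rule DomainI)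
  next
    fix f assume "f \<in> Domain (munn s)"
    then obtain b where "(f, b) \<in> munn s" by (rule DomainE)
    then obtain t where "t \<in> carrier S" "nat_le S t s" "f = rplus S t" by (rule munnE)
    then show "f \<in> {f \<in> proj S. nat_le S f (rplus S s)}" using s nat_le_plus by simp
  qed
  then show ?thesis
    using s by (simp add: munn_proj relcomp_converse_Id_on single_valued_munn_converse)
qed

lemma munn_star:
  assumes s: "s \<in> carrier S"
  shows "munn (rstar S s) = (munn s)\<inverse> O munn s"
proof -
  have "{f \<in> proj S. nat_le S f (rstar S s)} = Range (munn s)"
  proof (intro equalityI subsetI)
    fix f assume "f \<in> {f \<in> proj S. nat_le S f (rstar S s)}"
    then have f: "f \<in> proj S" "nat_le S f (rstar S s)" by simp_all
    have "f = rstar S (s \<otimes> f)"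
      using f s nat_le_iff_star[of f "rstar S s"] by (simp add: star_mult_proj proj_cases)
    then have "(rplus S (s \<otimes> f), f) \<in> munn s"
      using f s proj_cases(1)[of f] by (intro munnI[of "s \<otimes> f"]) (simp_all add: nat_le_mult_proj)
    then show "f \<in> Range (munn s)" by (rule RangeI)
  next
    fix f assume "f \<in> Range (munn s)"
    then obtain a where "(a, f) \<in> munn s" by (rule RangeE)
    then obtain t where "t \<in> carrier S" "nat_le S t s" "f = rstar S t" by (rule munnE)
    then show "f \<in> {f \<in> proj S. nat_le S f (rstar S s)}" using s nat_le_star by simp
  qed
  then show ?thesis
    using s relcomp_converse_Id_on[of "(munn s)\<inverse>"] by (simp add: munn_proj single_valued_munn)
qed

end

section \<open>The symmetric inverse monoid\<close>

definition sym_inv :: "'a set \<Rightarrow> 'a rel monoid" where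
  "sym_inv A = \<lparr>carrier = {r. r \<subseteq> A \<times> A \<and> single_valued r \<and> single_valued (r\<inverse>)},
     mult = (O), one = Id_on A\<rparr>"

lemma sym_inv_inverse_monoid: "inverse_monoid (sym_inv A)"
proof -
  interpret monoid "sym_inv A"
  proof
    fix r s assume "r \<in> carrier (sym_inv A)" "s \<in> carrier (sym_inv A)"
    then show "r \<otimes>\<^bsub>sym_inv A\<^esub> s \<in> carrier (sym_inv A)"
      by (auto simp: sym_inv_def single_valued_relcomp converse_relcomp)
  next
    fix r assume "r \<in> carrier (sym_inv A)"
    then have "r \<subseteq> A \<times> A" by (simp add: sym_inv_def)
    then show "\<one>\<^bsub>sym_inv A\<^esub> \<otimes>\<^bsub>sym_inv A\<^esub> r = r" "r \<otimes>\<^bsub>sym_inv A\<^esub> \<one>\<^bsub>sym_inv A\<^esub> = r"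
      unfolding sym_inv_def by auto
  qed (auto simp: sym_inv_def O_assoc)
  show ?thesis
  proof (rule inverse_monoidI[of converse])
    fix r s assume "r \<in> carrier (sym_inv A)" "s \<in> carrier (sym_inv A)"
    then have "r O r\<inverse> = Id_on (Domain r)" "s O s\<inverse> = Id_on (Domain s)"
      by (auto simp: sym_inv_def relcomp_converse_Id_on)
    then show "r \<otimes>\<^bsub>sym_inv A\<^esub> r\<inverse> \<otimes>\<^bsub>sym_inv A\<^esub> (s \<otimes>\<^bsub>sym_inv A\<^esub> s\<inverse>)
        = s \<otimes>\<^bsub>sym_inv A\<^esub> s\<inverse> \<otimes>\<^bsub>sym_inv A\<^esub> (r \<otimes>\<^bsub>sym_inv A\<^esub> r\<inverse>)"
      by (auto simp: sym_inv_def)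
  qed (auto simp: sym_inv_def converse_relcomp single_valued_relcomp_converse O_assoc)
qed

lemma sinv_sym_inv:
  assumes "r \<in> carrier (sym_inv A)"
  shows "sinv (sym_inv A) r = r\<inverse>"
proof -
  interpret inverse_monoid "sym_inv A" by (rule sym_inv_inverse_monoid)
  have "single_valued r" "single_valued (r\<inverse>)" using assms by (simp_all add: sym_inv_def)
  then show ?thesis
    using assms single_valued_relcomp_converse[of r] single_valued_relcomp_converse[of "r\<inverse>"]
    by (intro sinv_eqI) (auto simp: sym_inv_def O_assoc)
qed

lemma (in restriction_monoid) munn_restr_hom:
  "munn \<in> restr_hom S (inv_restr (sym_inv (proj S)))"
proof -
  have c: "munn s \<in> carrier (sym_inv (proj S))" if "s \<in> carrier S" for s
    using single_valued_munn[OF that] single_valued_munn_converse[OF that]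
    by (auto simp: sym_inv_def munn_def)
  moreover have "munn \<one> = Id_on (proj S)"
  proof -
    have "nat_le S f \<one>" if "f \<in> proj S" for f
      using that nat_le_proj_mult[of f \<one>] by (simp add: proj_cases)
    then show ?thesis by (auto simp: munn_proj)
  qed
  ultimately show ?thesis
    by (simp add: restr_hom_def mon_hom_def hom_def inv_restr_def sinv_sym_inv
         munn_plus munn_star munn_mult Pi_def) (simp add: sym_inv_def)
qed

section \<open>Premorphisms\<close>

lemma restr_homD:
  assumes "h \<in> restr_hom S T"
  shows "x \<in> carrier S \<Longrightarrow> h x \<in> carrier T"
    and "\<lbrakk>x \<in> carrier S; y \<in> carrier S\<rbrakk> \<Longrightarrow> h (x \<otimes>\<^bsub>S\<^esub> y) = h x \<otimes>\<^bsub>T\<^esub> h y"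
    and "h \<one>\<^bsub>S\<^esub> = \<one>\<^bsub>T\<^esub>"
    and "x \<in> carrier S \<Longrightarrow> h (rstar S x) = rstar T (h x)"
    and "x \<in> carrier S \<Longrightarrow> h (rplus S x) = rplus T (h x)"
  using assms by (auto simp: restr_hom_def mon_hom_def hom_def)

lemma id_restr_hom: "(\<lambda>x. x) \<in> restr_hom S S"
  by (auto simp: restr_hom_def mon_hom_def hom_def)

lemma restr_hom_comp:
  assumes "g \<in> restr_hom S T" "h \<in> restr_hom T U"
  shows "h \<circ> g \<in> restr_hom S U"
  using assms by (auto simp: restr_hom_def mon_hom_def hom_def Pi_def)

text \<open>Inverses are unique, so a monoid morphism preserves them and with them the derived
  operations.\<close>

lemma inv_restr_restr_hom:
  assumes "inverse_monoid S" "inverse_monoid T" and h: "h \<in> mon_hom S T"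
  shows "h \<in> restr_hom (inv_restr S) (inv_restr T)"
proof -
  interpret S: inverse_monoid S by fact
  interpret T: inverse_monoid T by fact
  have hc: "h x \<in> carrier T" if "x \<in> carrier S" for x
    using h that by (auto simp: mon_hom_def hom_def)
  have hm: "h (x \<otimes>\<^bsub>S\<^esub> y) = h x \<otimes>\<^bsub>T\<^esub> h y" if "x \<in> carrier S" "y \<in> carrier S" for x y
    using h that by (auto simp: mon_hom_def hom_def)
  have "sinv T (h x) = h (sinv S x)" if x: "x \<in> carrier S" for x
    using S.sinv_props[OF x] x
    by (intro T.sinv_eqI) (simp_all only: hc hm[symmetric] S.m_closed)
  with hc hm S.sinv_props(1) h show ?thesis
    by (simp add: restr_hom_def mon_hom_def hom_def inv_restr_def Pi_def)
qed

text \<open>A monoid seen as a restriction monoid whose only projection is the identity. It is the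
  codomain of \<open>\<sigma>\<close>.\<close>

definition trivial_restr :: "('a, 'b) monoid_scheme \<Rightarrow> 'a restr" where
  "trivial_restr M = \<lparr>carrier = carrier M, mult = mult M, one = \<one>\<^bsub>M\<^esub>,
     rstar = (\<lambda>_. \<one>\<^bsub>M\<^esub>), rplus = (\<lambda>_. \<one>\<^bsub>M\<^esub>)\<rparr>"

lemma (in monoid) trivial_restr_restriction_monoid: "restriction_monoid (trivial_restr G)"
  by unfold_locales (auto simp: trivial_restr_def m_assoc)

lemma trivial_restr_simps [simp]:
  "carrier (trivial_restr M) = carrier M" "x \<otimes>\<^bsub>trivial_restr M\<^esub> y = x \<otimes>\<^bsub>M\<^esub> y"
  "\<one>\<^bsub>trivial_restr M\<^esub> = \<one>\<^bsub>M\<^esub>" "rstar (trivial_restr M) x = \<one>\<^bsub>M\<^esub>"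
  "rplus (trivial_restr M) x = \<one>\<^bsub>M\<^esub>"
  by (simp_all add: trivial_restr_def)

section \<open>Transport of the defining relations\<close>

lemma Ball_premorphism_rels:
  "(\<forall>(s, t)\<in>premorphism_rels M X R T \<iota>. Q s t) \<longleftrightarrow>
     Q (\<iota> \<one>\<^bsub>M\<^esub>) \<one>\<^bsub>T\<^esub>
     \<and> (\<forall>m\<in>carrier M. \<forall>n\<in>carrier M.
          Q (\<iota> m \<otimes>\<^bsub>T\<^esub> \<iota> n) (\<iota> (m \<otimes>\<^bsub>M\<^esub> n) \<otimes>\<^bsub>T\<^esub> rstar T (\<iota> m \<otimes>\<^bsub>T\<^esub> \<iota> n)))
     \<and> (\<forall>(p, q)\<in>R. \<forall>s\<in>p. \<forall>t\<in>q. \<forall>f\<in>X \<rightarrow> carrier M.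
          Q (reval T (\<iota> \<circ> word_ext M f) s) (reval T (\<iota> \<circ> word_ext M f) t))"
  unfolding premorphism_rels_def by blast

text \<open>Meant for \<open>T\<close> a term algebra and \<open>h\<close> the evaluation of terms,
  which preserves the operations on all terms by definition. Respecting the formal relations then
  means that the same relations hold in the target.\<close>

lemma premorphism_rels_comp:
  fixes X :: "'x set" and T :: "'t restr"
  assumes "h \<one>\<^bsub>T\<^esub> = \<one>\<^bsub>T'\<^esub>" "\<And>x y. h (x \<otimes>\<^bsub>T\<^esub> y) = h x \<otimes>\<^bsub>T'\<^esub> h y"
    and "\<And>x. h (rstar T x) = rstar T' (h x)" "\<And>x. h (rplus T x) = rplus T' (h x)"
  shows "(\<forall>(s, t)\<in>premorphism_rels M X R T \<iota>. h s = h t)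
    \<longleftrightarrow> (\<forall>(s, t)\<in>premorphism_rels M X R T' (h \<circ> \<iota>). s = t)"
proof -
  have "h (reval T g s) = reval T' (h \<circ> g) s" for g :: "'x list \<Rightarrow> 't" and s
    by (induction s) (simp_all add: assms)
  then show ?thesis
    by (simp add: Ball_premorphism_rels assms comp_assoc)
qed

lemma reval_FR_rels_iff:
  "(\<forall>(s, t)\<in>FR_rels M X R. reval T \<gamma> s = reval T \<gamma> t)
    \<longleftrightarrow> (\<forall>(s, t)\<in>premorphism_rels M X R T \<gamma>. s = t)"
proof -
  have "reval T \<gamma> \<circ> RGen = \<gamma>" by auto
  then show ?thesis
    unfolding FR_rels_def
    by (subst premorphism_rels_comp[where T' = T]) (simp_all add: rterm_alg_def)
qed

text \<open>\<open>iterm_alg\<close> writes the unary operations through the formal inverse exactly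
  as \<open>inv_restr\<close> defines them through \<open>sinv\<close>.\<close>

lemma ieval_FI_rels_iff:
  "(\<forall>(s, t)\<in>FI_rels M X R. ieval S \<gamma> s = ieval S \<gamma> t)
    \<longleftrightarrow> (\<forall>(s, t)\<in>premorphism_rels M X R (inv_restr S) \<gamma>. s = t)"
proof -
  have "ieval S \<gamma> \<circ> IGen = \<gamma>" by auto
  then show ?thesis
    unfolding FI_rels_def
    by (subst premorphism_rels_comp[where T' = "inv_restr S"])
       (simp_all add: iterm_alg_def inv_restr_def)
qed

lemma rclass_mem_rterms:
  assumes "p \<in> carrier (rpres A \<rho>)" "s \<in> p"
  shows "s \<in> rterms A" "p = rcong A \<rho> `` {s}"
  using assms by (auto simp: rpres_carrier dest: rcong_rterms rclass_eqI)

text \<open>A form of \<open>reval_closed\<close> free of the restriction monoid laws, so that it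
  also covers term algebras.\<close>

lemma reval_mem:
  assumes "\<one>\<^bsub>T\<^esub> \<in> C" "\<And>x y. \<lbrakk>x \<in> C; y \<in> C\<rbrakk> \<Longrightarrow> x \<otimes>\<^bsub>T\<^esub> y \<in> C"
    and "\<And>x. x \<in> C \<Longrightarrow> rstar T x \<in> C" "\<And>x. x \<in> C \<Longrightarrow> rplus T x \<in> C"
    and "g \<in> A \<rightarrow> C" "t \<in> rterms A"
  shows "reval T g t \<in> C"
  using assms(6) by (induction t) (use assms(1-5) in auto)

text \<open>The \<open>base\<close> rules of \<open>rcong\<close> and \<open>icong\<close> accept
  only terms over the generating set; this supplies that side condition for the defining
  relations.\<close>

lemma premorphism_rels_closed:
  assumes "monoid M" and R: "R \<subseteq> carrier (FR_words X) \<times> carrier (FR_words X)"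
    and C: "\<one>\<^bsub>T\<^esub> \<in> C" "\<And>x y. \<lbrakk>x \<in> C; y \<in> C\<rbrakk> \<Longrightarrow> x \<otimes>\<^bsub>T\<^esub> y \<in> C"
      "\<And>x. x \<in> C \<Longrightarrow> rstar T x \<in> C" "\<And>x. x \<in> C \<Longrightarrow> rplus T x \<in> C"
    and \<iota>: "\<iota> \<in> carrier M \<rightarrow> C"
  shows "\<forall>(s, t)\<in>premorphism_rels M X R T \<iota>. s \<in> C \<and> t \<in> C"
proof -
  interpret monoid M by fact
  have "reval T (\<iota> \<circ> word_ext M f) s \<in> C"
    if "f \<in> X \<rightarrow> carrier M" "p \<in> carrier (FR_words X)" "s \<in> p" for f p s
  proof (rule reval_mem[OF C])
    show "\<iota> \<circ> word_ext M f \<in> lists X \<rightarrow> C"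
    proof
      fix u assume "u \<in> lists X"
      then have "word_ext M f u \<in> carrier M" by (rule word_ext_closed[OF that(1)])
      then show "(\<iota> \<circ> word_ext M f) u \<in> C" using \<iota> by auto
    qed
    show "s \<in> rterms (lists X)" using that(2,3) by (rule rclass_mem_rterms)
  qed
  moreover have "\<iota> m \<in> C" if "m \<in> carrier M" for m using \<iota> that by blast
  ultimately show ?thesis
    using R by (auto simp: Ball_premorphism_rels intro!: C)
qed

lemma ieval_ipres:
  assumes "s \<in> iterms A"
  shows "ieval (ipres A \<rho>) (\<lambda>a. icong A \<rho> `` {IGen a}) s = icong A \<rho> `` {s}"
  using assms by (induction s) (simp_all add: ipres_one ipres_mult ipres_sinv)

locale premorphism =
  M: monoid M + restriction_monoid S
  for M :: "('m, 'k) monoid_scheme" and S :: "('s, 'l) restr_scheme" (structure) +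
  fixes \<gamma> :: "'m \<Rightarrow> 's"
  assumes premorphism_closed: "m \<in> carrier M \<Longrightarrow> \<gamma> m \<in> carrier S"
    and premorphism_one: "\<gamma> \<one>\<^bsub>M\<^esub> = \<one>"
    and premorphism_mult: "\<lbrakk>m \<in> carrier M; n \<in> carrier M\<rbrakk>
      \<Longrightarrow> nat_le S (\<gamma> m \<otimes> \<gamma> n) (\<gamma> (m \<otimes>\<^bsub>M\<^esub> n))"
begin

text \<open>Induction on terms: products use monotonicity and the premorphism inequality, while the
  unary operations give projections, which lie below
  \<open>\<gamma> \<one> = \<one>\<close>.\<close>

lemma nat_le_gen:
  assumes "t \<in> rterms (carrier M)"
  shows "nat_le S (reval S \<gamma> t) (\<gamma> (reval (trivial_restr M) (\<lambda>m. m) t))"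
  using assms
proof (induction t)
  case (RMult s t)
  interpret T: restriction_monoid "trivial_restr M"
    by (rule M.trivial_restr_restriction_monoid)
  have c: "reval (trivial_restr M) (\<lambda>m. m) u \<in> carrier M" "reval S \<gamma> u \<in> carrier S"
    if "u \<in> rterms (carrier M)" for u
    using T.reval_closed[of "\<lambda>m. m" "carrier M" u] reval_closed[of \<gamma> "carrier M" u]
      premorphism_closed that by auto
  from RMult show ?case
    using c premorphism_closed
    by (auto intro!: nat_le_trans[OF nat_le_mult_mono premorphism_mult])
next
  case (RStar t)
  then have "reval S \<gamma> t \<in> carrier S"
    using premorphism_closed by (intro reval_closed) auto
  then show ?case
    using nat_le_proj_mult[of "rstar S (reval S \<gamma> t)" \<one>]
    by (simp add: premorphism_one)
next
  case (RPlus t)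
  then have "reval S \<gamma> t \<in> carrier S"
    using premorphism_closed by (intro reval_closed) auto
  then show ?case
    using nat_le_proj_mult[of "rplus S (reval S \<gamma> t)" \<one>]
    by (simp add: premorphism_one)
qed (simp_all add: premorphism_closed premorphism_one)

end

lemma premorphismI:
  assumes "monoid M" "restriction_monoid S" and \<gamma>: "\<gamma> \<in> carrier M \<rightarrow> carrier S"
    and rels: "\<forall>(s, t)\<in>premorphism_rels M X R S \<gamma>. s = t"
  shows "premorphism M S \<gamma>"
proof -
  interpret M: monoid M by fact
  interpret restriction_monoid S by fact
  show ?thesis
  proof
    show "m \<in> carrier M \<Longrightarrow> \<gamma> m \<in> carrier S" for m using \<gamma> by blast
    show "\<gamma> \<one>\<^bsub>M\<^esub> = \<one>\<^bsub>S\<^esub>" using rels by (simp add: Ball_premorphism_rels)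
  next
    fix m n assume mn: "m \<in> carrier M" "n \<in> carrier M"
    then have c: "\<gamma> m \<otimes>\<^bsub>S\<^esub> \<gamma> n \<in> carrier S" "\<gamma> (m \<otimes>\<^bsub>M\<^esub> n) \<in> carrier S"
      using \<gamma> by auto
    have "\<gamma> m \<otimes>\<^bsub>S\<^esub> \<gamma> n = \<gamma> (m \<otimes>\<^bsub>M\<^esub> n) \<otimes>\<^bsub>S\<^esub> rstar S (\<gamma> m \<otimes>\<^bsub>S\<^esub> \<gamma> n)"
      using rels mn by (simp add: Ball_premorphism_rels)
    then show "nat_le S (\<gamma> m \<otimes>\<^bsub>S\<^esub> \<gamma> n) (\<gamma> (m \<otimes>\<^bsub>M\<^esub> n))"
      using nat_le_iff_star[OF c] by simp
  qed
qed

section \<open>The universal monoids\<close>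

locale admissible_identities =
  fixes M :: "('m, 'k) monoid_scheme"
    and X :: "'x set"
    and R :: "('x list rterm set \<times> 'x list rterm set) set"
  assumes M: "monoid M"
    and R: "R \<subseteq> carrier (FR_words X) \<times> carrier (FR_words X)"
    and adm: "\<And>p q. (p, q) \<in> R \<Longrightarrow> admissible X (p, q)"
begin

sublocale M: monoid M
  by (rule M)

sublocale T: restriction_monoid "trivial_restr M"
  by (rule M.trivial_restr_restriction_monoid)

sublocale F: restriction_monoid "FR M X R"
  unfolding FR_def by (rule rpres_restriction_monoid)

sublocale J: inverse_monoid "ipres (carrier M) (FI_rels M X R)"
  by (rule ipres_inverse_monoid)

sublocale I: restriction_monoid "FI M X R"
  unfolding FI_def by (rule J.inv_restr_restriction_monoid)

lemma FR_carrierE: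
  assumes "P \<in> carrier (FR M X R)"
  obtains t where "t \<in> rterms (carrier M)" "P = rcong (carrier M) (FR_rels M X R) `` {t}"
  using assms by (auto simp: FR_def rpres_carrier)

lemma FI_carrier:
  "carrier (FI M X R) = (\<lambda>s. icong (carrier M) (FI_rels M X R) `` {s}) ` iterms (carrier M)"
  by (simp add: FI_def inv_restr_def ipres_carrier)

lemma FR_gen_closed: "FR_gen M X R \<in> carrier M \<rightarrow> carrier (FR M X R)"
  by (auto simp: FR_gen_def FR_def rpres_carrier)

lemma FI_gen_closed: "FI_gen M X R \<in> carrier M \<rightarrow> carrier (FI M X R)"
  by (auto simp: FI_gen_def FI_carrier)

text \<open>The generators satisfy the relations by construction and \<open>h\<close> preserves
  them. The cases of interest are the identity and the Munn representation.\<close>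

lemma FR_hom_rels:
  assumes h: "h \<in> restr_hom (FR M X R) S"
  shows "\<forall>(s, t)\<in>premorphism_rels M X R S (h \<circ> FR_gen M X R). s = t"
  unfolding reval_FR_rels_iff[symmetric]
proof safe
  fix s t assume st: "(s, t) \<in> FR_rels M X R"
  have "\<forall>(s, t)\<in>FR_rels M X R. s \<in> rterms (carrier M) \<and> t \<in> rterms (carrier M)"
    unfolding FR_rels_def
    by (rule premorphism_rels_closed[OF M R]) (auto simp: rterm_alg_def)
  with st have c: "s \<in> rterms (carrier M)" "t \<in> rterms (carrier M)" by auto
  have "rcong (carrier M) (FR_rels M X R) `` {s} = rcong (carrier M) (FR_rels M X R) `` {t}"
    using st c by (intro rclass_eqI rcong.base) auto
  moreover have "reval S (h \<circ> FR_gen M X R) u = h (rcong (carrier M) (FR_rels M X R) `` {u})"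
    if "u \<in> rterms (carrier M)" for u
    using restr_hom_reval[OF h[unfolded FR_def] that] by (simp add: comp_def FR_gen_def)
  ultimately show "reval S (h \<circ> FR_gen M X R) s = reval S (h \<circ> FR_gen M X R) t"
    using c by simp
qed

lemma FI_gen_rels: "\<forall>(s, t)\<in>premorphism_rels M X R (FI M X R) (FI_gen M X R). s = t"
proof -
  have "ieval (ipres (carrier M) (FI_rels M X R)) (FI_gen M X R) s
      = ieval (ipres (carrier M) (FI_rels M X R)) (FI_gen M X R) t"
    if st: "(s, t) \<in> FI_rels M X R" for s t
  proof -
    have "\<forall>(s, t)\<in>FI_rels M X R. s \<in> iterms (carrier M) \<and> t \<in> iterms (carrier M)"
      unfolding FI_rels_def
      by (rule premorphism_rels_closed[OF M R]) (auto simp: iterm_alg_def)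
    with st have c: "s \<in> iterms (carrier M)" "t \<in> iterms (carrier M)" by auto
    have "icong (carrier M) (FI_rels M X R) `` {s} = icong (carrier M) (FI_rels M X R) `` {t}"
      using st c by (intro iclass_eqI icong.base) auto
    then show ?thesis
      using c ieval_ipres[of _ "carrier M" "FI_rels M X R"] by (simp add: FI_gen_def[abs_def])
  qed
  then show ?thesis
    unfolding FI_def ieval_FI_rels_iff[symmetric] by blast
qed

text \<open>Here admissibility enters: the identity map of \<open>M\<close> is a monoid morphism
  into \<open>trivial_restr M\<close>, so it satisfies \<open>R\<close>. This makes
  \<open>\<sigma>\<close> well defined.\<close>

lemma trivial_rels: "\<forall>(s, t)\<in>premorphism_rels M X R (trivial_restr M) (\<lambda>m. m). s = t"
proof -
  have "reval (trivial_restr M) (word_ext M f) s = reval (trivial_restr M) (word_ext M f) t"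
    if pq: "(p, q) \<in> R" and s: "s \<in> p" and t: "t \<in> q" and f: "f \<in> X \<rightarrow> carrier M" for p q s t f
  proof -
    have c: "p \<in> carrier (FR_words X)" "q \<in> carrier (FR_words X)" using R pq by auto
    have "(\<lambda>m. m) \<in> mon_hom M (trivial_restr M)" by (auto simp: mon_hom_def hom_def)
    then have "satisfies X M (trivial_restr M) (\<lambda>m. m) (p, q)"
      by (rule admissible_satisfies[OF adm[OF pq] c M T.restriction_monoid_axioms])
    then have "rext (trivial_restr M) (word_ext M f) p = rext (trivial_restr M) (word_ext M f) q"
      using f by (auto simp: satisfies_def ident_value_def comp_def)
    moreover have g: "word_ext M f \<in> lists X \<rightarrow> carrier (trivial_restr M)"
      using M.word_ext_closed[OF f] by (intro Pi_I) simp
    have "rext (trivial_restr M) (word_ext M f) r = reval (trivial_restr M) (word_ext M f) u"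
      if "r \<in> carrier (FR_words X)" "u \<in> r" for r u
      using T.rext_class[OF g, of "{}" u] rclass_mem_rterms[OF that] by simp
    ultimately show ?thesis using c s t by metis
  qed
  then show ?thesis by (auto simp: Ball_premorphism_rels comp_def)
qed

section \<open>The morphisms \<open>\<pi>\<close> (here \<open>canon\<close>) and
  \<open>\<sigma>\<close> (here \<open>degree\<close>)\<close>

definition canon :: "'m rterm set \<Rightarrow> 'm iterm set" where
  "canon = rext (FI M X R) (FI_gen M X R)"

definition degree :: "'m rterm set \<Rightarrow> 'm" where
  "degree = rext (trivial_restr M) (\<lambda>m. m)"

lemma canon_hom: "canon \<in> restr_hom (FR M X R) (FI M X R)"
  and canon_gen: "m \<in> carrier M \<Longrightarrow> canon (FR_gen M X R m) = FI_gen M X R m"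
  using I.rext_morphism[OF FI_gen_closed, of "FR_rels M X R"] FI_gen_rels
  by (simp_all add: canon_def FR_gen_def FR_def reval_FR_rels_iff)

lemma degree_hom: "degree \<in> restr_hom (FR M X R) (trivial_restr M)"
  and degree_gen: "m \<in> carrier M \<Longrightarrow> degree (FR_gen M X R m) = m"
  using T.rext_morphism[of "\<lambda>m. m" "carrier M" "FR_rels M X R"] trivial_rels
  by (simp_all add: degree_def FR_gen_def FR_def reval_FR_rels_iff)

lemmas canonD = restr_homD[OF canon_hom]
lemmas degreeD = restr_homD[OF degree_hom, simplified]

text \<open>The generator map of \<open>FR M X R\<close> is itself a premorphism, and evaluating a
  term at it returns the class of the term, so \<open>nat_le_gen\<close> applies.\<close>

lemma nat_le_degree:
  assumes P: "P \<in> carrier (FR M X R)"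
  shows "nat_le (FR M X R) P (FR_gen M X R (degree P))"
proof -
  interpret premorphism M "FR M X R" "FR_gen M X R"
    using FR_hom_rels[OF id_restr_hom]
    by (intro premorphismI[OF M F.restriction_monoid_axioms FR_gen_closed]) (simp add: comp_def)
  obtain t where t: "t \<in> rterms (carrier M)" "P = rcong (carrier M) (FR_rels M X R) `` {t}"
    using P by (rule FR_carrierE)
  have "reval (FR M X R) (FR_gen M X R) t = P"
    using restr_hom_reval[OF id_restr_hom t(1)] t(2) by (simp add: FR_def FR_gen_def[abs_def])
  moreover have "degree P = reval (trivial_restr M) (\<lambda>m. m) t"
    unfolding degree_def t(2)
    using trivial_rels t(1) by (intro T.rext_class) (simp_all add: reval_FR_rels_iff)
  ultimately show ?thesis using nat_le_gen[OF t(1)] by simp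
qed

lemma nat_le_canon:
  assumes P: "P \<in> carrier (FR M X R)"
  shows "nat_le (FI M X R) (canon P) (FI_gen M X R (degree P))"
proof -
  have d: "degree P \<in> carrier M" using P by (rule degreeD)
  then have g: "FR_gen M X R (degree P) \<in> carrier (FR M X R)" using FR_gen_closed by blast
  have "P = rplus (FR M X R) P \<otimes>\<^bsub>FR M X R\<^esub> FR_gen M X R (degree P)"
    using nat_le_degree[OF P] F.nat_le_iff_plus[OF P g] by simp
  then have "canon P = rplus (FI M X R) (canon P) \<otimes>\<^bsub>FI M X R\<^esub> FI_gen M X R (degree P)"
    using P g d canonD(2)[of "rplus (FR M X R) P"] canonD(5) by (metis F.plus_closed canon_gen)
  then show ?thesis
    using I.nat_le_proj_mult[OF I.plus_proj[OF canonD(1)[OF P]]] by metis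
qed

section \<open>The morphism \<open>eta\<close>\<close>

definition eta :: "'m rterm set \<Rightarrow> 'm iterm set \<times> 'm" where
  "eta P = (rplus (FI M X R) (canon P), degree P)"

lemma proj_FI: "idems (FI M X R) = proj (FI M X R)"
  unfolding FI_def J.proj_inv_restr by (simp add: idems_def inv_restr_def)

lemma EFI_carrier:
  "carrier (EFI_product M X R) = {(e, m). e \<in> proj (FI M X R) \<and> m \<in> carrier M
     \<and> nat_le (FI M X R) e (rplus (FI M X R) (FI_gen M X R m))}"
  by (simp add: partial_action_product_def proj_FI)

lemma canon_factor:
  assumes P: "P \<in> carrier (FR M X R)"
  shows "rplus (FI M X R) (canon P) \<otimes>\<^bsub>FI M X R\<^esub> FI_gen M X R (degree P) = canon P"
proof -
  have "FI_gen M X R (degree P) \<in> carrier (FI M X R)"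
    using FI_gen_closed degreeD(1)[OF P] by blast
  then show ?thesis using nat_le_canon[OF P] I.nat_le_iff_plus canonD(1)[OF P] by metis
qed

lemma eta_hom: "eta \<in> restr_hom (FR M X R) (EFI_product M X R)"
proof -
  have g: "FI_gen M X R (degree P) \<in> carrier (FI M X R)" if "P \<in> carrier (FR M X R)" for P
    using FI_gen_closed degreeD(1)[OF that] by blast
  have "eta P \<in> carrier (EFI_product M X R)" if P: "P \<in> carrier (FR M X R)" for P
    using I.nat_le_plus[OF nat_le_canon[OF P] canonD(1)[OF P] g[OF P]] P
    by (simp add: EFI_carrier eta_def canonD degreeD)
  moreover have "eta (P \<otimes>\<^bsub>FR M X R\<^esub> Q) = eta P \<otimes>\<^bsub>EFI_product M X R\<^esub> eta Q"
    if P: "P \<in> carrier (FR M X R)" and Q: "Q \<in> carrier (FR M X R)" for P Q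
  proof -
    let ?e = "rplus (FI M X R) (canon P)" and ?f = "rplus (FI M X R) (canon Q)"
    let ?m = "FI_gen M X R (degree P)"
    have "?e \<otimes>\<^bsub>FI M X R\<^esub> rplus (FI M X R) (?m \<otimes>\<^bsub>FI M X R\<^esub> ?f)
        = rplus (FI M X R) (?e \<otimes>\<^bsub>FI M X R\<^esub> (?m \<otimes>\<^bsub>FI M X R\<^esub> ?f))"
      using P Q g by (intro I.plus_proj_mult[symmetric]) (simp_all add: canonD)
    also have "\<dots> = rplus (FI M X R) (canon P \<otimes>\<^bsub>FI M X R\<^esub> ?f)"
      using P Q g canon_factor[OF P] by (simp add: canonD flip: I.m_assoc)
    also have "\<dots> = rplus (FI M X R) (canon P \<otimes>\<^bsub>FI M X R\<^esub> canon Q)"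
      using P Q by (simp add: canonD I.plus_mult_plus)
    finally show ?thesis
      using P Q by (simp add: eta_def partial_action_product_def canonD degreeD)
  qed
  moreover have "eta \<one>\<^bsub>FR M X R\<^esub> = \<one>\<^bsub>EFI_product M X R\<^esub>"
    using I.one_proj by (simp add: eta_def partial_action_product_def canonD degreeD I.proj_cases)
  moreover have "eta (rstar (FR M X R) P) = rstar (EFI_product M X R) (eta P)
      \<and> eta (rplus (FR M X R) P) = rplus (EFI_product M X R) (eta P)"
    if P: "P \<in> carrier (FR M X R)" for P
    \<comment> \<open>In the product, \<open>rstar\<close> of \<open>eta P\<close> is computed from
      \<open>rplus (canon P)\<close> times the generator of \<open>degree P\<close>, which is
      \<open>canon P\<close> again.\<close>
    using P canon_factor[OF P]
    by (simp add: eta_def partial_action_product_def canonD degreeD I.plus_star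
        I.proj_cases(2)[OF I.plus_proj])
  ultimately show ?thesis
    by (simp add: restr_hom_def mon_hom_def hom_def Pi_def)
qed

lemma is_eta_eta: "is_eta M X R eta"
  using eta_hom by (simp add: is_eta_def eta_def canon_gen degree_gen)

section \<open>Injectivity of \<open>eta\<close>\<close>

lemma canon_inj_on_proj: "inj_on canon (proj (FR M X R))"
proof -
  let ?S = "sym_inv (proj (FR M X R))"
  interpret S: inverse_monoid ?S by (rule sym_inv_inverse_monoid)
  let ?g = "F.munn \<circ> FR_gen M X R"
  define \<psi> where "\<psi> = iext ?S ?g"
  have g: "?g \<in> carrier M \<rightarrow> carrier ?S"
  proof
    fix m assume "m \<in> carrier M"
    then have "FR_gen M X R m \<in> carrier (FR M X R)" using FR_gen_closed by blast
    from restr_homD(1)[OF F.munn_restr_hom this] show "?g m \<in> carrier ?S"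
      by (simp add: inv_restr_def)
  qed
  \<comment> \<open>The Munn representation restricted to generators is a premorphism satisfying
    \<open>R\<close> with values in an inverse monoid, so the universal property of
    \<open>FI M X R\<close> yields \<open>\<psi>\<close>.\<close>
  have rels: "\<forall>(s, t)\<in>FI_rels M X R. ieval ?S ?g s = ieval ?S ?g t"
    unfolding ieval_FI_rels_iff by (rule FR_hom_rels[OF F.munn_restr_hom])
  have "\<psi> \<in> mon_hom (ipres (carrier M) (FI_rels M X R)) ?S"
    unfolding \<psi>_def by (rule S.iext_morphism(1)[OF g rels])
  then have \<psi>: "\<psi> \<in> restr_hom (FI M X R) (inv_restr ?S)"
    unfolding FI_def
    by (rule inv_restr_restr_hom[OF J.inverse_monoid_axioms S.inverse_monoid_axioms])
  \<comment> \<open>Both sides are morphisms on \<open>FR M X R\<close>, so agreement on generators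
    suffices.\<close>
  have eq: "(\<psi> \<circ> canon) P = F.munn P" if P: "P \<in> carrier (FR M X R)" for P
  proof (rule rext_unique)
    show "\<psi> \<circ> canon \<in> restr_hom (rpres (carrier M) (FR_rels M X R)) (inv_restr ?S)"
      using restr_hom_comp[OF canon_hom \<psi>] by (simp add: FR_def)
    show "F.munn \<in> restr_hom (rpres (carrier M) (FR_rels M X R)) (inv_restr ?S)"
      using F.munn_restr_hom by (simp add: FR_def)
    show "P \<in> carrier (rpres (carrier M) (FR_rels M X R))"
      using P by (simp add: FR_def)
  next
    fix m assume m: "m \<in> carrier M"
    have "\<psi> (FI_gen M X R m) = ?g m"
      unfolding \<psi>_def FI_gen_def by (rule S.iext_morphism(2)[OF g rels m])
    then show "(\<psi> \<circ> canon) (rcong (carrier M) (FR_rels M X R) `` {RGen m})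
        = F.munn (rcong (carrier M) (FR_rels M X R) `` {RGen m})"
      using canon_gen[OF m] by (simp add: FR_gen_def)
  qed
  show ?thesis
  proof (rule inj_onI)
    fix P Q assume PQ: "P \<in> proj (FR M X R)" "Q \<in> proj (FR M X R)" "canon P = canon Q"
    then have "F.munn P = F.munn Q"
      using eq[of P] eq[of Q] F.proj_cases(1) by simp
    then show "P = Q" using F.munn_inj_on_proj PQ by (simp add: inj_onD)
  qed
qed

text \<open>\<open>P\<close> is the product of \<open>P\<^sup>+\<close> and the generator of its
  degree. The second component of \<open>eta P\<close> gives the degree, and the first is
  \<open>canon (P\<^sup>+)\<close>, which determines \<open>P\<^sup>+\<close>.\<close>

lemma eta_inj: "inj_on eta (carrier (FR M X R))"
proof (rule inj_onI)
  fix P Q assume P: "P \<in> carrier (FR M X R)" and Q: "Q \<in> carrier (FR M X R)"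
    and eq: "eta P = eta Q"
  have g: "FR_gen M X R (degree P) \<in> carrier (FR M X R)"
    using degreeD(1)[OF P] FR_gen_closed by blast
  have d: "degree P = degree Q" using eq by (simp add: eta_def)
  have "canon (rplus (FR M X R) P) = canon (rplus (FR M X R) Q)"
    using eq P Q by (simp add: eta_def canonD)
  then have "rplus (FR M X R) P = rplus (FR M X R) Q"
    using inj_onD[OF canon_inj_on_proj] P Q by simp
  then show "P = Q"
    using nat_le_degree[OF P] nat_le_degree[OF Q] P Q g d
      F.nat_le_iff_plus[OF P g] F.nat_le_iff_plus[of Q] by metis
qed

text \<open>The idempotents of \<open>\<F>\<I>\<^sub>R(M)\<close> are obtained from the identity by the maps
  \<open>f \<mapsto> ([m] f)\<^sup>+\<close> and \<open>f \<mapsto> (f [m])\<^sup>*\<close>, which lift to \<open>\<F>\<R>\<^sub>R(M)\<close>.\<close>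

lemma plus_star_canon_image:
  assumes "t \<in> iterms (carrier M)" "f \<in> canon ` proj (FR M X R)"
  defines "x \<equiv> icong (carrier M) (FI_rels M X R) `` {t}"
  shows "rplus (FI M X R) (x \<otimes>\<^bsub>FI M X R\<^esub> f) \<in> canon ` proj (FR M X R)"
    and "rstar (FI M X R) (f \<otimes>\<^bsub>FI M X R\<^esub> x) \<in> canon ` proj (FR M X R)"
proof -
  let ?c = "\<lambda>t. icong (carrier M) (FI_rels M X R) `` {t}"
  define K where "K = canon ` proj (FR M X R)"
  have K: "f \<in> proj (FI M X R)" if "f \<in> K" for f
    using that canonD by (auto simp: proj_def K_def)
  have Kc: "f \<in> carrier (FI M X R)" if "f \<in> K" for f
    using K[OF that] by (rule I.proj_cases)
  have c: "?c t \<in> carrier (FI M X R)" if "t \<in> iterms (carrier M)" for t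
    using that by (simp add: FI_carrier)
  \<comment> \<open>The claim ranges over all \<open>f\<close> in \<open>K\<close> because the
    product case applies one hypothesis to the result of the other. The two closure properties are
    proved together because inversion exchanges them.\<close>
  have main: "\<forall>f\<in>K. rplus (FI M X R) (?c t \<otimes>\<^bsub>FI M X R\<^esub> f) \<in> K
      \<and> rstar (FI M X R) (f \<otimes>\<^bsub>FI M X R\<^esub> ?c t) \<in> K"
    using assms(1)
  proof (induction t)
    case (IGen m)
    then have m: "m \<in> carrier M" by simp
    then have g: "FR_gen M X R m \<in> carrier (FR M X R)" using FR_gen_closed by blast
    have cm: "?c (IGen m) = canon (FR_gen M X R m)" using canon_gen[OF m] by (simp add: FI_gen_def)
    show ?case
    proof
      fix f assume "f \<in> K"
      then obtain p where p: "p \<in> proj (FR M X R)" "f = canon p" by (auto simp: K_def)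
      have pc: "p \<in> carrier (FR M X R)" using p(1) by (rule F.proj_cases)
      have "rplus (FI M X R) (?c (IGen m) \<otimes>\<^bsub>FI M X R\<^esub> f)
          = canon (rplus (FR M X R) (FR_gen M X R m \<otimes>\<^bsub>FR M X R\<^esub> p))"
        "rstar (FI M X R) (f \<otimes>\<^bsub>FI M X R\<^esub> ?c (IGen m))
          = canon (rstar (FR M X R) (p \<otimes>\<^bsub>FR M X R\<^esub> FR_gen M X R m))"
        unfolding cm p(2) using g pc by (simp_all add: canonD)
      then show "rplus (FI M X R) (?c (IGen m) \<otimes>\<^bsub>FI M X R\<^esub> f) \<in> K
          \<and> rstar (FI M X R) (f \<otimes>\<^bsub>FI M X R\<^esub> ?c (IGen m)) \<in> K"
        using g pc by (simp add: K_def)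
    qed
  next
    case IOne
    have "?c IOne = \<one>\<^bsub>FI M X R\<^esub>" by (simp add: FI_def inv_restr_def ipres_one)
    then show ?case using K Kc by (simp add: I.proj_cases)
  next
    case (IMult s t)
    then have st: "s \<in> iterms (carrier M)" "t \<in> iterms (carrier M)" by auto
    then have "?c (s \<odot> t) = ?c s \<otimes>\<^bsub>FI M X R\<^esub> ?c t"
      by (simp add: FI_def inv_restr_def ipres_mult)
    moreover have "rplus (FI M X R) (?c s \<otimes>\<^bsub>FI M X R\<^esub> ?c t \<otimes>\<^bsub>FI M X R\<^esub> f)
        = rplus (FI M X R) (?c s \<otimes>\<^bsub>FI M X R\<^esub> rplus (FI M X R) (?c t \<otimes>\<^bsub>FI M X R\<^esub> f))"
      "rstar (FI M X R) (f \<otimes>\<^bsub>FI M X R\<^esub> (?c s \<otimes>\<^bsub>FI M X R\<^esub> ?c t))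
        = rstar (FI M X R) (rstar (FI M X R) (f \<otimes>\<^bsub>FI M X R\<^esub> ?c s) \<otimes>\<^bsub>FI M X R\<^esub> ?c t)"
      if "f \<in> K" for f
      using c[OF st(1)] c[OF st(2)] Kc[OF that]
      by (simp_all add: I.plus_mult_plus I.star_star_mult I.m_assoc)
    ultimately show ?case
      using bspec[OF IMult.IH(1)[OF st(1)]] bspec[OF IMult.IH(2)[OF st(2)]] by auto
  next
    case (IInv t)
    then have t: "t \<in> iterms (carrier M)" by simp
    let ?J = "ipres (carrier M) (FI_rels M X R)"
    have ct: "?c t \<in> carrier ?J" using t by (simp add: ipres_carrier)
    have inv: "?c (IInv t) = sinv ?J (?c t)" using t by (simp add: ipres_sinv)
    \<comment> \<open>As \<open>f\<close> is its own inverse, both sides of the first equation are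
      \<open>t\<^sup>-\<^sup>1 f f t\<close>, and both sides of the second are
      \<open>t f f t\<^sup>-\<^sup>1\<close>.\<close>
    have "rplus (FI M X R) (?c (IInv t) \<otimes>\<^bsub>FI M X R\<^esub> f) = rstar (FI M X R) (f \<otimes>\<^bsub>FI M X R\<^esub> ?c t)
        \<and> rstar (FI M X R) (f \<otimes>\<^bsub>FI M X R\<^esub> ?c (IInv t)) = rplus (FI M X R) (?c t \<otimes>\<^bsub>FI M X R\<^esub> f)"
      if "f \<in> K" for f
    proof -
      have f: "f \<in> carrier ?J" "f \<otimes>\<^bsub>?J\<^esub> f = f"
        using I.proj_cases[OF K[OF that]] by (simp_all add: FI_def inv_restr_def)
      then have "sinv ?J f = f" by (rule J.sinv_idem)
      then show ?thesis
        unfolding inv using ct f J.sinv_props(1)[OF ct]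
        by (simp add: FI_def inv_restr_def J.sinv_mult J.sinv_sinv)
    qed
    then show ?case using IInv t by simp
  qed
  then show "rplus (FI M X R) (x \<otimes>\<^bsub>FI M X R\<^esub> f) \<in> canon ` proj (FR M X R)"
    "rstar (FI M X R) (f \<otimes>\<^bsub>FI M X R\<^esub> x) \<in> canon ` proj (FR M X R)"
    using bspec[OF main, of f] assms(2) by (simp_all only: x_def K_def)
qed

text \<open>A projection \<open>e\<close> is \<open>(e \<one>)\<^sup>+\<close>, so it arises from
  \<open>\<one> = canon \<one>\<close> by the closure property above, applied to a term for
  \<open>e\<close>.\<close>

lemma proj_FI_subset: "proj (FI M X R) \<subseteq> canon ` proj (FR M X R)"
proof
  fix e assume e: "e \<in> proj (FI M X R)"
  then obtain t where t: "t \<in> iterms (carrier M)"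
    "e = icong (carrier M) (FI_rels M X R) `` {t}"
    using I.proj_cases(1)[OF e] by (auto simp: FI_carrier)
  have "\<one>\<^bsub>FI M X R\<^esub> \<in> canon ` proj (FR M X R)"
    by (rule image_eqI[of _ canon "\<one>\<^bsub>FR M X R\<^esub>"]) (simp_all add: canonD)
  from plus_star_canon_image(1)[OF t(1) this]
  have "rplus (FI M X R) (e \<otimes>\<^bsub>FI M X R\<^esub> \<one>\<^bsub>FI M X R\<^esub>) \<in> canon ` proj (FR M X R)"
    unfolding t(2) .
  then show "e \<in> canon ` proj (FR M X R)"
    by (simp only: I.r_one I.proj_cases[OF e])
qed

lemma eta_surj: "carrier (EFI_product M X R) \<subseteq> eta ` carrier (FR M X R)"
proof
  fix x assume "x \<in> carrier (EFI_product M X R)"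
  then obtain e m where x: "x = (e, m)" and e: "e \<in> proj (FI M X R)" and m: "m \<in> carrier M"
    and le: "nat_le (FI M X R) e (rplus (FI M X R) (FI_gen M X R m))"
    by (auto simp: EFI_carrier)
  obtain p where p: "p \<in> proj (FR M X R)" "e = canon p" using proj_FI_subset e by blast
  have pc: "p \<in> carrier (FR M X R)" using p(1) by (rule F.proj_cases)
  have g: "FR_gen M X R m \<in> carrier (FR M X R)" "FI_gen M X R m \<in> carrier (FI M X R)"
    using FR_gen_closed FI_gen_closed m by blast+
  have "rplus (FI M X R) (e \<otimes>\<^bsub>FI M X R\<^esub> FI_gen M X R m)
      = e \<otimes>\<^bsub>FI M X R\<^esub> rplus (FI M X R) (FI_gen M X R m)"
    using e g by (simp add: I.plus_proj_mult)
  \<comment> \<open>The carrier condition that \<open>e\<close> lies below \<open>rplus\<close> of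
    the generator of \<open>m\<close> is what makes the first component come out as
    \<open>e\<close>.\<close>
  also have "\<dots> = e"
    using le e g I.nat_le_iff_plus[of e "rplus (FI M X R) (FI_gen M X R m)"]
    by (simp add: I.proj_cases)
  finally have "rplus (FI M X R) (e \<otimes>\<^bsub>FI M X R\<^esub> FI_gen M X R m) = e" .
  \<comment> \<open>\<open>p\<close> equals its own \<open>rstar\<close>, and \<open>rstar\<close>
    is constantly \<open>\<one>\<close> in \<open>trivial_restr M\<close>.\<close>
  moreover have "degree p = \<one>\<^bsub>M\<^esub>"
    using degreeD(4)[OF pc] F.proj_cases(3)[OF p(1)] by simp
  ultimately have "eta (p \<otimes>\<^bsub>FR M X R\<^esub> FR_gen M X R m) = x"
    using pc g m by (simp add: eta_def x p(2) canonD degreeD canon_gen degree_gen)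
  then show "x \<in> eta ` carrier (FR M X R)"
    using pc g by (intro image_eqI[of x eta "p \<otimes>\<^bsub>FR M X R\<^esub> FR_gen M X R m"]) simp_all
qed

lemma eta_bij: "bij_betw eta (carrier (FR M X R)) (carrier (EFI_product M X R))"
proof (rule bij_betw_imageI[OF eta_inj])
  show "eta ` carrier (FR M X R) = carrier (EFI_product M X R)"
    by (rule equalityI[OF image_subsetI[OF restr_homD(1)[OF eta_hom]] eta_surj])
qed

end

theorem theorem6p7:
  fixes M :: "('m, 'k) monoid_scheme"
    and X :: "'x set"
    and R :: "('x list rterm set \<times> 'x list rterm set) set"
  assumes "monoid M"
    and "R \<subseteq> carrier (FR_words X) \<times> carrier (FR_words X)"
    and "\<And>p q. (p, q) \<in> R \<Longrightarrow> admissible X (p, q)"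
  shows "(\<exists>\<eta>. is_eta M X R \<eta>) \<and>
         (\<forall>\<eta>. is_eta M X R \<eta> \<longrightarrow> \<eta> \<in> restr_iso (FR M X R) (EFI_product M X R))"
proof -
  interpret admissible_identities M X R
    by (rule admissible_identities.intro[OF assms])
  have "\<eta> \<in> restr_iso (FR M X R) (EFI_product M X R)" if \<eta>: "is_eta M X R \<eta>" for \<eta>
  proof -
    \<comment> \<open>\<open>is_eta\<close> fixes \<open>\<eta>\<close> only on the carrier, where
      it agrees with \<open>eta\<close>; bijectivity needs no more.\<close>
    have "bij_betw \<eta> (carrier (FR M X R)) (carrier (EFI_product M X R))"
      by (rule iffD2[OF bij_betw_cong[OF eta_unique[OF \<eta> is_eta_eta]] eta_bij])
    then show ?thesis using \<eta> by (simp add: restr_iso_def is_eta_def)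
  qed
  then show ?thesis using is_eta_eta by blast
qed

end
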